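(* Every connected locally finite non-amenable plane graph $G$ is roundabout-transient, i.e. its roundabout graph $G^\circ$ is transient.
   Context: All graphs are simple (no loops or parallel edges). A graph is locally finite if every vertex has finite degree. A plane graph (planar map) is a graph endowed with a fixed embedding in the plane $\mathbb{R}^2$. For a vertex set $S$, $\partial S$ denotes the set of vertices not in $S$ that have a neighbour in $S$. An infinite graph $G$ is non-amenable if there is a constant $\gamma>0$ such that $|\partial S|\ge\gamma|S|$ for every finite set $S$ of vertices of $G$. Roundabout graph: for a locally finite plane graph $G$, the roundabout graph $G^\circ$ has as vertices the pairs $(v,e)$ where $e$ is an edge of $G$ and $v$ is an endvertex of $e$. For each edge $e$ of $G$ with endvertices $v,w$ there is an edge between $(v,e)$ and $(w,e)$. For each vertex $v$ and any two edges $e,f$ that are consecutive in the cyclic order that the embedding induces on the edges incident with $v$, there is an edge between $(v,e)$ and $(v,f)$. Thus each vertex $v$ is replaced by a cycle (its roundabout) of length $\deg(v)$ (degenerate if $\deg(v)\le 2$). A connected graph is transient if simple random walk on it almost surely visits any fixed vertex only finitely often. *)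

theory Defs
  imports "HOL-Probability.Probability"
begin

record 'v graph =
  vertices :: "'v set"
  edges :: "'v set set"

definition simple_graph :: "('v, 'z) graph_scheme \<Rightarrow> bool" where
  "simple_graph G \<longleftrightarrow> (\<forall>e\<in>edges G. e \<subseteq> vertices G \<and> card e = 2)"

definition incident_edges :: "('v, 'z) graph_scheme \<Rightarrow> 'v \<Rightarrow> 'v set set" where
  "incident_edges G v = {e \<in> edges G. v \<in> e}"

definition neighbours :: "('v, 'z) graph_scheme \<Rightarrow> 'v \<Rightarrow> 'v set" where
  "neighbours G v = {w. {v, w} \<in> edges G}"

definition locally_finite :: "('v, 'z) graph_scheme \<Rightarrow> bool" where
  "locally_finite G \<longleftrightarrow> (\<forall>v\<in>vertices G. finite (incident_edges G v))"

definition connected_graph :: "('v, 'z) graph_scheme \<Rightarrow> bool" where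
  "connected_graph G \<longleftrightarrow> vertices G \<noteq> {} \<and>
     (\<forall>u\<in>vertices G. \<forall>v\<in>vertices G. (u, v) \<in> {(x, y). {x, y} \<in> edges G}\<^sup>*)"

definition vertex_boundary :: "('v, 'z) graph_scheme \<Rightarrow> 'v set \<Rightarrow> 'v set" where
  "vertex_boundary G S = {w \<in> vertices G - S. \<exists>v\<in>S. {v, w} \<in> edges G}"

text \<open>Meant for locally finite graphs, where the boundary of a finite set is finite, so that
  \<^const>\<open>card\<close> is its true cardinality.\<close>

definition nonamenable :: "('v, 'z) graph_scheme \<Rightarrow> bool" where
  "nonamenable G \<longleftrightarrow> infinite (vertices G) \<and>
     (\<exists>\<gamma>::real. \<gamma> > 0 \<and>
        (\<forall>S. S \<subseteq> vertices G \<and> finite S \<longrightarrow>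
           real (card (vertex_boundary G S)) \<ge> \<gamma> * real (card S)))"

text \<open>A graph together with a drawing in the plane, identified with \<^typ>\<open>complex\<close>. The arc of an
  edge carries a parametrisation in one of the two directions, chosen arbitrarily.\<close>

record 'v plane_graph = "'v graph" +
  pos :: "'v \<Rightarrow> complex"
  arc_of :: "'v set \<Rightarrow> real \<Rightarrow> complex"

definition drawing :: "('v, 'z) plane_graph_scheme \<Rightarrow> complex set" where
  "drawing G = pos G ` vertices G \<union> (\<Union>e\<in>edges G. path_image (arc_of G e))"

text \<open>The first five conditions say that the drawing is an injective map from the 1-complex of
  \<open>G\<close> to the plane that is continuous on each closed edge. The last one says that this map is a
  homeomorphism onto its image: the subspace topology of the drawing is the weak topology of the
  1-complex, in which a set is closed as soon as it meets every closed edge in a closed set. (The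
  converse implication holds automatically, as arcs are compact.)\<close>

definition is_plane_graph :: "('v, 'z) plane_graph_scheme \<Rightarrow> bool" where
  "is_plane_graph G \<longleftrightarrow>
     simple_graph G \<and>
     inj_on (pos G) (vertices G) \<and>
     (\<forall>e\<in>edges G. arc (arc_of G e) \<and>
        {pathstart (arc_of G e), pathfinish (arc_of G e)} = pos G ` e) \<and>
     (\<forall>e\<in>edges G. path_image (arc_of G e) \<inter> pos G ` vertices G = pos G ` e) \<and>
     (\<forall>e\<in>edges G. \<forall>f\<in>edges G. e \<noteq> f \<longrightarrow>
        path_image (arc_of G e) \<inter> path_image (arc_of G f) = pos G ` (e \<inter> f)) \<and>
     (\<forall>C\<subseteq>drawing G. (\<forall>e\<in>edges G. closed (C \<inter> path_image (arc_of G e))) \<longrightarrow>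
        closedin (top_of_set (drawing G)) C)"

definition arc_from :: "('v, 'z) plane_graph_scheme \<Rightarrow> 'v \<Rightarrow> 'v set \<Rightarrow> real \<Rightarrow> complex" where
  "arc_from G v e =
     (if pathstart (arc_of G e) = pos G v then arc_of G e else reversepath (arc_of G e))"

text \<open>The point where \<open>e\<close>, followed from its endvertex \<open>v\<close>, first meets the circle of radius \<open>r\<close>
  around \<open>v\<close>. It exists for all sufficiently small positive \<open>r\<close>.\<close>

definition first_hit :: "('v, 'z) plane_graph_scheme \<Rightarrow> 'v \<Rightarrow> real \<Rightarrow> 'v set \<Rightarrow> complex" where
  "first_hit G v r e =
     arc_from G v e (Inf {t \<in> {0..1}. dist (pos G v) (arc_from G v e t) = r})"

definition ccw_angle :: "complex \<Rightarrow> complex \<Rightarrow> complex \<Rightarrow> real" where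
  "ccw_angle c p q = Arg2pi ((q - c) / (p - c))"

text \<open>\<open>ccw_order G v e f g\<close>: turning counterclockwise around \<open>v\<close> from \<open>e\<close>, one meets \<open>f\<close> strictly
  before \<open>g\<close>. Arcs need not have tangents at \<open>v\<close>, so the order is read off from their first hitting
  points on small circles; the cyclic order of these points does not depend on the (small) radius,
  since up to these points the arcs form a star that lies in the disc and meets its boundary
  circle in the tips only.\<close>

definition ccw_order ::
  "('v, 'z) plane_graph_scheme \<Rightarrow> 'v \<Rightarrow> 'v set \<Rightarrow> 'v set \<Rightarrow> 'v set \<Rightarrow> bool" where
  "ccw_order G v e f g \<longleftrightarrow>
     e \<in> incident_edges G v \<and> f \<in> incident_edges G v \<and> g \<in> incident_edges G v \<and>
     e \<noteq> f \<and> f \<noteq> g \<and> e \<noteq> g \<and>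
     (\<forall>\<^sub>F r in at_right 0.
        ccw_angle (pos G v) (first_hit G v r e) (first_hit G v r f) <
        ccw_angle (pos G v) (first_hit G v r e) (first_hit G v r g))"

definition consecutive :: "('v, 'z) plane_graph_scheme \<Rightarrow> 'v \<Rightarrow> 'v set \<Rightarrow> 'v set \<Rightarrow> bool" where
  "consecutive G v e f \<longleftrightarrow>
     e \<in> incident_edges G v \<and> f \<in> incident_edges G v \<and> e \<noteq> f \<and>
     ((\<nexists>g. ccw_order G v e g f) \<or> (\<nexists>g. ccw_order G v f g e))"

text \<open>This is again a simple graph: the degenerate cycle at a vertex of degree 2 is a single edge,
  and at a vertex of degree 1 a single vertex without a loop.\<close>

definition roundabout :: "('v, 'z) plane_graph_scheme \<Rightarrow> ('v \<times> 'v set) graph" where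
  "roundabout G =
     \<lparr> vertices = {(v, e). e \<in> edges G \<and> v \<in> e},
       edges = {{(v, e), (w, e)} | v w e. e \<in> edges G \<and> e = {v, w}} \<union>
               {{(v, e), (v, f)} | v e f. v \<in> vertices G \<and> consecutive G v e f} \<rparr>"

text \<open>The law of step \<open>n\<close> of the walk started at \<open>x\<close>, given the trajectory \<open>\<omega>\<close> before time \<open>n\<close>.\<close>

fun srw_kernel :: "'v graph \<Rightarrow> 'v \<Rightarrow> nat \<Rightarrow> (nat \<Rightarrow> 'v) \<Rightarrow> 'v measure" where
  "srw_kernel G x 0 \<omega> = measure_pmf (return_pmf x)"
| "srw_kernel G x (Suc n) \<omega> = measure_pmf (pmf_of_set (neighbours G (\<omega> n)))"

lemma Ionescu_Tulcea_srw: "Ionescu_Tulcea (srw_kernel G x) (\<lambda>_. count_space UNIV)"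
proof (rule Ionescu_Tulcea.intro)
  fix i
  show "srw_kernel G x i
    \<in> measurable (PiM {0..<i} (\<lambda>_. count_space UNIV)) (subprob_algebra (count_space UNIV))"
  proof (cases i)
    case 0
    then have "srw_kernel G x i = (\<lambda>_. measure_pmf (return_pmf x))"
      by (auto simp: fun_eq_iff)
    then show ?thesis
      by (simp only:) (intro measurable_const measure_pmf_in_subprob_algebra)
  next
    case (Suc n)
    have "(\<lambda>\<omega>. \<omega> n) \<in> measurable (PiM {0..<i} (\<lambda>_. count_space UNIV)) (count_space UNIV)"
      using Suc by (intro measurable_component_singleton) auto
    from measurable_compose[OF this measurable_measure_pmf[of "\<lambda>y. pmf_of_set (neighbours G y)"]]
    moreover have "srw_kernel G x i = (\<lambda>\<omega>. measure_pmf (pmf_of_set (neighbours G (\<omega> n))))"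
      using Suc by (auto simp: fun_eq_iff)
    ultimately show ?thesis
      by simp
  qed
next
  fix i \<omega>
  show "prob_space (srw_kernel G x i \<omega>)"
    by (cases i) (simp_all add: prob_space_measure_pmf)
qed

global_interpretation srw: Ionescu_Tulcea "srw_kernel G x" "\<lambda>_. count_space UNIV" for G x
  by (rule Ionescu_Tulcea_srw)

text \<open>The law of the whole trajectory, on the product space of functions \<^typ>\<open>nat \<Rightarrow> 'v\<close>,
  provided by the Ionescu-Tulcea theorem.\<close>

definition simple_random_walk :: "'v graph \<Rightarrow> 'v \<Rightarrow> (nat \<Rightarrow> 'v) measure" where
  "simple_random_walk G x = srw.PF.lim G x"

text \<open>Meant for connected locally finite graphs without isolated vertices, so that every
  \<^term>\<open>neighbours G x\<close> is finite and nonempty.\<close>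

definition transient :: "'v graph \<Rightarrow> bool" where
  "transient G \<longleftrightarrow>
     (\<forall>x\<in>vertices G. \<forall>y\<in>vertices G. AE \<omega> in simple_random_walk G x. finite {n. \<omega> n = y})"

definition roundabout_transient :: "('v, 'z) plane_graph_scheme \<Rightarrow> bool" where
  "roundabout_transient G \<longleftrightarrow> transient (roundabout G)"

end

theory Submission
  imports Defs
begin

text \<open>
  Planarity enters only through Euler's inequality: a finite set \<open>S\<close> of vertices of a plane graph
  spans at most \<open>3 |S|\<close> edges. The roundabout graph has small degrees, so it is transient as soon as
  every finite set \<open>T\<close> of its vertices has an edge boundary of size at least \<open>c |T|\<close>.

  To see this isoperimetric inequality, call a vertex \<open>v\<close> of \<open>G\<close> full if \<open>T\<close> contains its whole
  roundabout, and split if \<open>T\<close> contains a nonempty proper part of it. A roundabout is connected, so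
  each split vertex contributes a boundary edge. A pair \<open>(v, e)\<close> in \<open>T\<close> either has its partner at the
  other end of \<open>e\<close> outside \<open>T\<close>, which is a boundary edge again, or \<open>e\<close> joins two vertices that are
  full or split; by Euler's inequality there are at most three times as many such edges as there are full
  and split vertices. Finally, a vertex of \<open>G\<close> next to the set \<open>A\<close> of full vertices is split or sees a
  boundary edge, so non-amenability of \<open>G\<close> bounds \<open>|A|\<close> by the boundary as well. See
  \<open>isoperimetry_opened_roundabout\<close>.

  For transience, Cheeger's argument turns the isoperimetric inequality into a Poincare inequality
  \<open>\<Sum> f\<^sup>2 \<le> c \<E>(f)\<close> for finitely supported \<open>f\<close>, where \<open>\<E>\<close> is the Dirichlet energy. Applied to the
  truncated Green function \<open>\<Sum>n<N. p\<^sub>n(\<cdot>, z)\<close>, whose energy is at most a multiple of its value at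
  \<open>z\<close>, this bounds the expected number of visits uniformly in \<open>N\<close>. Energies grow with the edge set,
  hence both inequalities may be proved for a subgraph: each roundabout is cut open into a path, and the
  degrees are at most three by construction. This subgraph is read off from the first hitting points on one
  small circle around each vertex.

  Euler's inequality is proved for arbitrary arcs. A short piece of each arc is replaced by a chord of a disc
  that meets nothing else of the drawing, so that each edge visibly has two sides. The Jordan curve theorem shows
  that a chord that closes a cycle separates its two sides, which yields many faces; Janiszewski's theorem
  shows that each face touches at least three chords, and each chord touches at most two faces.
\<close>

section \<open>Preliminaries on separation and on equivalence classes\<close>

text \<open>Iterates Janiszewski's theorem: a planar set built by attaching non-separating pieces along connected
  intersections does not separate the plane.\<close>

lemma connected_complement_Un_family:
  fixes S :: "complex set"
  assumes "compact S" "connected (- S)" "finite F"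
    and "\<And>T. T \<in> F \<Longrightarrow> compact T \<and> connected (- T)"
    and "\<And>T F'. T \<in> F \<Longrightarrow> F' \<subseteq> F \<Longrightarrow> T \<notin> F' \<Longrightarrow> connected ((S \<union> \<Union>F') \<inter> T)"
  shows "connected (- (S \<union> \<Union>F))"
  using assms(3-5)
proof (induction F rule: finite_induct)
  case empty
  then show ?case using assms by simp
next
  case (insert T F)
  have "compact (S \<union> \<Union>F)"
    using assms(1) insert.hyps(1) insert.prems(1) by (intro compact_Un compact_Union) auto
  moreover have "closed T" "connected (- T)"
    using insert.prems(1) by (auto simp: compact_imp_closed)
  moreover have "connected ((S \<union> \<Union>F) \<inter> T)"
    using insert.prems(2)[of T F] insert.hyps(2) by auto
  moreover have "connected (- (S \<union> \<Union>F))"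
  proof (rule insert.IH)
    show "\<And>T. T \<in> F \<Longrightarrow> compact T \<and> connected (- T)"
      using insert.prems(1) by auto
    show "\<And>T F'. T \<in> F \<Longrightarrow> F' \<subseteq> F \<Longrightarrow> T \<notin> F' \<Longrightarrow> connected ((S \<union> \<Union>F') \<inter> T)"
      using insert.prems(2) by blast
  qed
  ultimately have "connected (- ((S \<union> \<Union>F) \<union> T))"
    by (metis Janiszewski_connected)
  then show ?case
    by (simp add: Un_ac Int_ac)
qed

text \<open>In the count of edges, the classes are the components of the part of the drawing built so far; the
  strict inequality is the loss of a component when an edge joins two of them.\<close>

lemma card_quotient_mono:
  assumes V: "finite V" and r: "equiv V r" and s: "equiv V s" and sub: "r \<subseteq> s"
  shows "card (V // s) \<le> card (V // r)" and "r \<noteq> s \<Longrightarrow> card (V // s) < card (V // r)"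
proof -
  have s_im: "s `` (r `` {x}) = s `` {x}" if "x \<in> V" for x
  proof -
    have "(x, x) \<in> r" using r that by (auto simp: equiv_def refl_on_def)
    moreover have "trans s" using s by (auto simp: equiv_def)
    ultimately show ?thesis using sub by (auto simp: trans_def)
  qed
  have img: "V // s = (\<lambda>C. s `` C) ` (V // r)"
    using s_im by (force simp: quotient_def image_iff)
  have fin: "finite (V // r)"
    using V r by (auto simp: quotient_def)
  show "card (V // s) \<le> card (V // r)"
    unfolding img by (rule card_image_le[OF fin])
  assume "r \<noteq> s"
  then obtain x y where xy: "(x, y) \<in> s" "(x, y) \<notin> r" using sub by auto
  then have V': "x \<in> V" "y \<in> V" using s by (auto simp: equiv_def refl_on_def)
  have "\<not> inj_on (\<lambda>C. s `` C) (V // r)"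
  proof
    assume inj: "inj_on (\<lambda>C. s `` C) (V // r)"
    have "s `` (r `` {x}) = s `` (r `` {y})"
      using s_im V' xy(1) s by (simp add: equiv_class_eq)
    then have "r `` {x} = r `` {y}"
      using inj V' by (auto simp: inj_on_def quotientI)
    then show False using xy(2) V' r by (simp add: eq_equiv_class_iff)
  qed
  then show "card (V // s) < card (V // r)"
    unfolding img using card_image_le[OF fin] eq_card_imp_inj_on[OF fin]
    by (metis le_neq_implies_less)
qed

section \<open>Euler's inequality for drawings with chords\<close>

text \<open>The curve of an edge \<open>e\<close> runs from \<open>a e\<close> along \<open>P e\<close> to the tip \<open>x e\<close>, crosses the disc around
  \<open>m e\<close> on a chord to the tip \<open>y e\<close>, and reaches \<open>b e\<close> along the reverse of \<open>Q e\<close>. The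
  disc makes the two sides of the edge accessible, which are hard to define for a general arc.\<close>

locale chorded_drawing =
  fixes V :: "complex set" and E :: "'e set"
    and a b :: "'e \<Rightarrow> complex" and P Q :: "'e \<Rightarrow> real \<Rightarrow> complex"
    and m :: "'e \<Rightarrow> complex" and r :: "'e \<Rightarrow> real"
  fixes x y chord curve
  defines "x e \<equiv> pathfinish (P e)" and "y e \<equiv> pathfinish (Q e)"
    and "chord e \<equiv> closed_segment (x e) (y e)"
    and "curve e \<equiv> path_image (P e) \<union> chord e \<union> path_image (Q e)"
  assumes finV: "finite V" and finE: "finite E"
    and r_pos: "e \<in> E \<Longrightarrow> r e > 0"
    and arc_P: "e \<in> E \<Longrightarrow> arc (P e)" and arc_Q: "e \<in> E \<Longrightarrow> arc (Q e)"
    and start_P: "e \<in> E \<Longrightarrow> pathstart (P e) = a e" and start_Q: "e \<in> E \<Longrightarrow> pathstart (Q e) = b e"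
    and P_disc: "e \<in> E \<Longrightarrow> path_image (P e) \<inter> cball (m e) (r e) = {x e}"
    and Q_disc: "e \<in> E \<Longrightarrow> path_image (Q e) \<inter> cball (m e) (r e) = {y e}"
    and tips: "e \<in> E \<Longrightarrow> dist (m e) (x e) = r e \<and> dist (m e) (y e) = r e"
    and PQ: "e \<in> E \<Longrightarrow> path_image (P e) \<inter> path_image (Q e) = {}"
    and curve_V: "e \<in> E \<Longrightarrow> curve e \<inter> V = {a e, b e}"
    and curve_curve: "e \<in> E \<Longrightarrow> f \<in> E \<Longrightarrow> e \<noteq> f \<Longrightarrow> curve e \<inter> curve f \<subseteq> V"
    and simple: "e \<in> E \<Longrightarrow> f \<in> E \<Longrightarrow> e \<noteq> f \<Longrightarrow> {a e, b e} \<noteq> {a f, b f}"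
    and disc_curve: "e \<in> E \<Longrightarrow> f \<in> E \<Longrightarrow> e \<noteq> f \<Longrightarrow> cball (m e) (r e) \<inter> curve f = {}"
    and disc_V: "e \<in> E \<Longrightarrow> cball (m e) (r e) \<inter> V = {}"
begin

text \<open>Removing all open chords leaves a disjoint union of stars and isolated vertices, which has no cycles.
  Chords are then added one by one.\<close>

definition K where "K = V \<union> (\<Union>e\<in>E. path_image (P e) \<union> path_image (Q e))"

definition X where "X M = K \<union> (\<Union>e\<in>M. chord e)"

lemma ends: "e \<in> E \<Longrightarrow> a e \<in> path_image (P e) \<and> x e \<in> path_image (P e) \<and>
    b e \<in> path_image (Q e) \<and> y e \<in> path_image (Q e)"
  unfolding x_def y_def using start_P start_Q
  by (metis pathfinish_in_path_image pathstart_in_path_image)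

lemma ends_V: "e \<in> E \<Longrightarrow> a e \<in> V \<and> b e \<in> V \<and> a e \<noteq> b e \<and> x e \<noteq> y e"
  using curve_V[of e] ends[of e] PQ[of e] by auto

lemma compact_chord: "compact (chord e)"
  unfolding chord_def by simp

lemma compact_pieces: "e \<in> E \<Longrightarrow> compact (path_image (P e)) \<and> compact (path_image (Q e))"
  using arc_P arc_Q by (auto simp: compact_path_image arc_imp_path)

lemma compact_K: "compact K"
  unfolding K_def using finV finE compact_pieces
  by (intro compact_Un compact_UN) (auto simp: finite_imp_compact)

lemma compact_X: "M \<subseteq> E \<Longrightarrow> compact (X M)"
  unfolding X_def using compact_K finE
  by (intro compact_Un compact_UN) (auto simp: compact_chord finite_subset)

lemma X_mono: "M \<subseteq> N \<Longrightarrow> X M \<subseteq> X N"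
  unfolding X_def by auto

lemma X_insert: "X (insert e M) = X M \<union> chord e"
  unfolding X_def by auto

lemma open_chord_disc: "e \<in> E \<Longrightarrow> open_segment (x e) (y e) \<subseteq> ball (m e) (r e)"
  using dist_decreases_open_segment[of _ "x e" "y e" "m e"] tips by fastforce

lemma chord_disc: "e \<in> E \<Longrightarrow> chord e \<inter> ball (m e) (r e) = open_segment (x e) (y e)"
  using open_chord_disc tips[of e] unfolding chord_def closed_segment_eq_open
  by (auto simp: dist_commute)

lemma disc_K: "e \<in> E \<Longrightarrow> ball (m e) (r e) \<inter> K = {}"
proof -
  assume e: "e \<in> E"
  have "ball (m e) (r e) \<inter> (path_image (P f) \<union> path_image (Q f)) = {}" if "f \<in> E" for f
  proof (cases "f = e")
    case True
    have "x e \<notin> ball (m e) (r e)" "y e \<notin> ball (m e) (r e)" using tips[OF e] by auto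
    moreover have "z = x e \<or> z = y e"
      if "z \<in> ball (m e) (r e)" "z \<in> path_image (P e) \<union> path_image (Q e)" for z
    proof -
      have "z \<in> path_image (P e) \<inter> cball (m e) (r e) \<or> z \<in> path_image (Q e) \<inter> cball (m e) (r e)"
        using that by auto
      then show ?thesis unfolding P_disc[OF e] Q_disc[OF e] by simp
    qed
    ultimately show ?thesis unfolding True by blast
  next
    case False
    then show ?thesis using disc_curve[OF e that] ball_subset_cball unfolding curve_def by blast
  qed
  then show ?thesis unfolding K_def using disc_V[OF e] ball_subset_cball by blast
qed

lemma disc_chord: "e \<in> E \<Longrightarrow> f \<in> E \<Longrightarrow> e \<noteq> f \<Longrightarrow> ball (m e) (r e) \<inter> chord f = {}"
  using disc_curve ball_subset_cball unfolding curve_def by blast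

lemma disc_X: "e \<in> E \<Longrightarrow> M \<subseteq> E \<Longrightarrow>
    ball (m e) (r e) \<inter> X M = (if e \<in> M then open_segment (x e) (y e) else {})"
proof -
  assume e: "e \<in> E" "M \<subseteq> E"
  have "ball (m e) (r e) \<inter> X M = (\<Union>f\<in>M. ball (m e) (r e) \<inter> chord f)"
    using disc_K[OF e(1)] unfolding X_def by blast
  also have "\<dots> = (\<Union>f\<in>M. if f = e then open_segment (x e) (y e) else {})"
    using disc_chord[OF e(1)] chord_disc[OF e(1)] e(2)
    by (intro SUP_cong) (auto simp: Int_commute)
  finally show ?thesis by auto
qed

lemma chord_X: "e \<in> E \<Longrightarrow> M \<subseteq> E \<Longrightarrow> e \<notin> M \<Longrightarrow> chord e \<inter> X M = {x e, y e}"
proof -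
  assume e: "e \<in> E" "M \<subseteq> E" "e \<notin> M"
  have "open_segment (x e) (y e) \<inter> X M = {}"
    using disc_X[OF e(1,2)] open_chord_disc[OF e(1)] e(3) by auto
  moreover have "x e \<in> X M" "y e \<in> X M"
    using ends[OF e(1)] e(1) unfolding X_def K_def by auto
  ultimately show ?thesis
    unfolding chord_def closed_segment_eq_open by auto
qed

definition side where "side e z = Im ((z - x e) / (y e - x e))"

definition half where "half e s = {z \<in> ball (m e) (r e). if s then side e z > 0 else side e z < 0}"

text \<open>The sides of a chord in its disc are convex, hence connected: each lies in a single face.\<close>

lemma convex_half: "convex (half e s)"
proof -
  have lin: "linear (\<lambda>z. Im (z / (y e - x e)))"
    by (rule linearI) (simp_all add: add_divide_distrib scaleR_conv_of_real
        flip: times_divide_eq_right)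
  have eq: "side e z = Im (z / (y e - x e)) - Im (x e / (y e - x e))" for z
    by (simp add: side_def diff_divide_distrib)
  have "convex {z. side e z > 0}"
    using convex_linear_vimage[OF lin, of "{Im (x e / (y e - x e))<..}"]
    unfolding eq by (simp add: vimage_def)
  moreover have "convex {z. side e z < 0}"
    using convex_linear_vimage[OF lin, of "{..<Im (x e / (y e - x e))}"]
    unfolding eq by (simp add: vimage_def)
  moreover have "half e s = ball (m e) (r e) \<inter> {z. if s then side e z > 0 else side e z < 0}"
    by (auto simp: half_def)
  ultimately show ?thesis
    by (cases s) (auto intro!: convex_Int)
qed

lemma disc_cases:
  assumes e: "e \<in> E" and z: "z \<in> ball (m e) (r e)"
  shows "z \<in> open_segment (x e) (y e) \<or> z \<in> half e True \<or> z \<in> half e False"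
proof (cases "side e z = 0")
  case True
  have ne: "x e \<noteq> y e" using ends_V[OF e] by auto
  define t where "t = Re ((z - x e) / (y e - x e))"
  have "(z - x e) / (y e - x e) = of_real t"
    using True by (auto simp: side_def t_def complex_eq_iff)
  then have "z - x e = of_real t * (y e - x e)" using ne by (simp add: divide_eq_eq)
  then have zt: "z = (1 - t) *\<^sub>R x e + t *\<^sub>R y e"
    by (simp add: scaleR_conv_of_real algebra_simps)
  have d: "dist (m e) (x e) = r e" "dist (m e) (y e) = r e" "dist (m e) z < r e"
    using tips[OF e] z by (auto simp: dist_commute)
  have "0 < t"
  proof (rule ccontr)
    assume "\<not> 0 < t"
    \<comment> \<open>then \<open>x e = (1 - u) z + u (y e)\<close>, and the strictly convex disc would contain \<open>x e\<close> in its interior\<close>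
    define u where "u = - t / (1 - t)"
    have u: "0 \<le> u" "u < 1" using \<open>\<not> 0 < t\<close> by (auto simp: u_def field_simps)
    have "(1 - t) *\<^sub>R ((1 - u) *\<^sub>R z + u *\<^sub>R y e) = (1 - t) *\<^sub>R x e"
    proof -
      have "(1 - t) * (1 - u) = 1" "(1 - t) * u = - t"
        using \<open>\<not> 0 < t\<close> by (auto simp: u_def field_simps)
      then have "(1 - t) *\<^sub>R ((1 - u) *\<^sub>R z + u *\<^sub>R y e) = z - t *\<^sub>R y e"
        by (simp add: scaleR_add_right)
      then show ?thesis by (simp add: zt)
    qed
    then have xz: "x e = (1 - u) *\<^sub>R z + u *\<^sub>R y e" using \<open>\<not> 0 < t\<close> by simp
    show False
    proof (cases "u = 0")
      case True
      then show ?thesis using xz d by simp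
    next
      case False
      have "z \<noteq> y e" using d by auto
      then have "x e \<in> open_segment z (y e)"
        using xz u False unfolding in_segment by (metis less_eq_real_def)
      moreover have "open_segment z (y e) \<subseteq> ball (m e) (r e)"
        using d dist_decreases_open_segment[of _ z "y e" "m e"] by fastforce
      ultimately show False using d by auto
    qed
  qed
  moreover have "t < 1"
  proof (rule ccontr)
    assume "\<not> t < 1"
    define u where "u = 1 - 1 / t"
    have u: "0 \<le> u" "u < 1" using \<open>\<not> t < 1\<close> by (auto simp: u_def field_simps)
    have "t *\<^sub>R ((1 - u) *\<^sub>R z + u *\<^sub>R x e) = t *\<^sub>R y e"
    proof -
      have "t * (1 - u) = 1" "t * u = t - 1"
        using \<open>\<not> t < 1\<close> by (auto simp: u_def field_simps)
      then have "t *\<^sub>R ((1 - u) *\<^sub>R z + u *\<^sub>R x e) = z + (t - 1) *\<^sub>R x e"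
        by (simp add: scaleR_add_right)
      then show ?thesis by (simp add: zt scaleR_left_diff_distrib)
    qed
    then have yz: "y e = (1 - u) *\<^sub>R z + u *\<^sub>R x e" using \<open>\<not> t < 1\<close> by simp
    show False
    proof (cases "u = 0")
      case True
      then show ?thesis using yz d by simp
    next
      case False
      have "z \<noteq> x e" using d by auto
      then have "y e \<in> open_segment z (x e)"
        using yz u False unfolding in_segment by (metis less_eq_real_def)
      moreover have "open_segment z (x e) \<subseteq> ball (m e) (r e)"
        using d dist_decreases_open_segment[of _ z "x e" "m e"] by fastforce
      ultimately show False using d by auto
    qed
  qed
  ultimately show ?thesis using zt ne by (auto simp: in_segment)
next
  case False
  then show ?thesis using z by (auto simp: half_def)
qed

lemma side_chord: "e \<in> E \<Longrightarrow> z \<in> chord e \<Longrightarrow> side e z = 0"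
proof -
  assume e: "e \<in> E" and z: "z \<in> chord e"
  have ne: "x e \<noteq> y e" using ends_V[OF e] by auto
  obtain t where "z = (1 - t) *\<^sub>R x e + t *\<^sub>R y e"
    using z unfolding chord_def by (auto simp: in_segment)
  then have "z - x e = of_real t * (y e - x e)"
    by (simp add: scaleR_conv_of_real algebra_simps)
  then show ?thesis using ne by (simp add: side_def)
qed

lemma half_X: "e \<in> E \<Longrightarrow> M \<subseteq> E \<Longrightarrow> half e s \<inter> X M = {}"
proof -
  assume e: "e \<in> E" "M \<subseteq> E"
  have "side e z \<noteq> 0 \<and> z \<in> ball (m e) (r e)" if "z \<in> half e s" for z
    using that unfolding half_def by (auto split: if_splits)
  moreover have "open_segment (x e) (y e) \<subseteq> chord e"
    unfolding chord_def by (rule segment_open_subset_closed)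
  moreover have "ball (m e) (r e) \<inter> X M \<subseteq> open_segment (x e) (y e)"
    unfolding disc_X[OF e] by simp
  ultimately have "z \<notin> X M" if "z \<in> half e s" for z
    using that side_chord[OF e(1), of z] by (meson IntI subset_iff)
  then show ?thesis by auto
qed

definition mid where "mid e = midpoint (x e) (y e)"

lemma mid: "e \<in> E \<Longrightarrow> mid e \<in> open_segment (x e) (y e)"
  unfolding mid_def using ends_V[of e] by simp

lemma half_nonempty: "e \<in> E \<Longrightarrow> half e s \<noteq> {}"
proof -
  assume e: "e \<in> E"
  have ne: "x e \<noteq> y e" using ends_V[OF e] by auto
  have c: "mid e \<in> ball (m e) (r e)" using mid[OF e] open_chord_disc[OF e] by auto
  then obtain d where d: "d > 0" "ball (mid e) d \<subseteq> ball (m e) (r e)"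
    using open_contains_ball open_ball by meson
  define w where "w = (if s then \<i> else - \<i>) * (y e - x e)"
  define h where "h = d / (2 * cmod (y e - x e))"
  have h: "h > 0" using d ne by (simp add: h_def)
  let ?z = "mid e + of_real h * w"
  have "cmod (of_real h * w) = d / 2"
  proof -
    have "cmod (of_real h * w) = h * cmod (y e - x e)"
      using h by (simp add: w_def norm_mult)
    then show ?thesis using ne by (simp add: h_def)
  qed
  then have "dist (mid e) ?z < d" using d(1) by (simp add: dist_norm)
  then have "?z \<in> ball (m e) (r e)" using d(2) by auto
  moreover have "side e ?z = (if s then h else - h)"
  proof -
    have "side e ?z = side e (mid e) + Im (of_real h * w / (y e - x e))"
      by (simp add: side_def diff_divide_distrib add_divide_distrib)
    moreover have "side e (mid e) = 0"
      using side_chord[OF e] mid[OF e] unfolding chord_def closed_segment_eq_open by auto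
    moreover have "of_real h * w / (y e - x e) = of_real h * (if s then \<i> else - \<i>)"
      using ne by (simp add: w_def)
    ultimately show ?thesis by simp
  qed
  ultimately show ?thesis using h by (auto simp: half_def)
qed

text \<open>If the tips are already joined within the drawing, a path between them and the chord form a Jordan
  curve. Both its inside and its outside accumulate at the midpoint of the chord, and near this point only
  the two half discs are off the curve, so one half lies inside and the other outside.\<close>

lemma halves_separated:
  assumes e: "e \<in> E" and M: "M \<subseteq> E" "e \<notin> M"
    and path: "path_component (X M) (x e) (y e)"
    and z: "z \<in> half e True" "z' \<in> half e False"
  shows "\<not> connected_component (- X (insert e M)) z z'"
proof
  assume con: "connected_component (- X (insert e M)) z z'"
  have ne: "x e \<noteq> y e" using ends_V[OF e] by auto
  obtain g where g: "path g" "path_image g \<subseteq> X M" "pathstart g = y e" "pathfinish g = x e"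
    using path path_component_sym[of "X M" "x e" "y e"] unfolding path_component_def by blast
  obtain q where q: "arc q" "path_image q \<subseteq> X M" "pathstart q = y e" "pathfinish q = x e"
    using path_contains_arc[OF g(1,3,4)] ne g(2) by (metis order_trans)
  define c where "c = linepath (x e) (y e) +++ q"
  have im: "path_image c = chord e \<union> path_image q"
    unfolding c_def chord_def using q by (simp add: path_image_join)
  have "chord e \<inter> path_image q \<subseteq> {x e, y e}"
    using chord_X[OF e M] q(2) by auto
  then have sp: "simple_path c" "pathfinish c = pathstart c"
    unfolding c_def chord_def using q ne
    by (auto intro!: simple_path_join_loop)
  note J = Jordan_inside_outside[OF sp]
  let ?I = "inside (path_image c)" and ?O = "outside (path_image c)"
  have cX: "path_image c \<subseteq> X (insert e M)"
    using q(2) im unfolding X_insert by auto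
  have mem: "mid e \<in> path_image c"
    using mid[OF e] unfolding im chord_def closed_segment_eq_open by auto
  have ball: "open (ball (m e) (r e))" "mid e \<in> ball (m e) (r e)"
    using mid[OF e] open_chord_disc[OF e] by auto
  have ex: "\<exists>w s. w \<in> half e s \<and> w \<in> U" if U: "U \<inter> path_image c = {}" "mid e \<in> frontier U" for U
  proof -
    have "mid e \<in> closure U" using U(2) by (simp add: frontier_def)
    then obtain w where w: "w \<in> U" "w \<in> ball (m e) (r e)"
      using ball closure_iff_nhds_not_empty[of "mid e" U] by blast
    have "w \<notin> open_segment (x e) (y e)"
      using w(1) U(1) im segment_open_subset_closed[of "x e" "y e"] unfolding chord_def by blast
    then show ?thesis
      using disc_cases[OF e w(2)] w(1) by blast
  qed
  obtain u s where u: "u \<in> half e s" "u \<in> ?I"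
    using ex[of ?I] J mem inside_no_overlap by metis
  obtain v t where v: "v \<in> half e t" "v \<in> ?O"
    using ex[of ?O] J mem outside_no_overlap by metis
  have half_con: "connected_component (- X (insert e M)) p q" if "p \<in> half e s" "q \<in> half e s" for p q s
  proof -
    have "half e s \<subseteq> - X (insert e M)"
      using half_X[OF e, of "insert e M" s] e M(1) by blast
    then show ?thesis
      unfolding connected_component_def using that convex_connected[OF convex_half] by blast
  qed
  have "connected_component (- X (insert e M)) u v"
  proof -
    have *: "connected_component (- X (insert e M)) p z" if "p \<in> half e s" for p s
    proof (cases s)
      case True
      then show ?thesis using half_con[of p True z] that z(1) by simp
    next
      case False
      then have "connected_component (- X (insert e M)) p z'"
        using half_con[of p False z'] that z(2) by simp
      then show ?thesis
        using con connected_component_sym connected_component_trans by metis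
    qed
    show ?thesis
      using *[OF u(1)] *[OF v(1)] connected_component_sym connected_component_trans by metis
  qed
  then have "connected_component (- path_image c) u v"
    using connected_component_of_subset cX by (metis Compl_subset_Compl_iff)
  then obtain S where S: "connected S" "S \<subseteq> - path_image c" "u \<in> S" "v \<in> S"
    unfolding connected_component_def by blast
  then show False
    using connectedD[OF S(1), of ?I ?O] J u v by blast
qed

lemma curve_arc: "e \<in> E \<Longrightarrow> \<exists>g. arc g \<and> path_image g = curve e"
proof -
  assume e: "e \<in> E"
  have ne: "x e \<noteq> y e" using ends_V[OF e] by auto
  have chord: "path_image (linepath (x e) (y e)) = chord e" by (simp add: chord_def)
  have fin: "pathfinish (P e) = x e" "pathfinish (Q e) = y e" by (simp_all add: x_def y_def)
  have "z \<in> cball (m e) (r e)" if "z \<in> chord e" for z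
    using that tips[OF e] open_chord_disc[OF e] ball_subset_cball
    unfolding chord_def closed_segment_eq_open by auto
  then have int: "path_image (P e) \<inter> chord e \<subseteq> {x e}" "path_image (Q e) \<inter> chord e \<subseteq> {y e}"
    using P_disc[OF e] Q_disc[OF e] by auto
  define j where "j = P e +++ linepath (x e) (y e)"
  have j: "arc j"
    unfolding j_def using arc_P[OF e] ne int(1) chord fin by (intro arc_join) auto
  have img: "path_image j = path_image (P e) \<union> chord e" "pathfinish j = y e"
    using fin chord by (simp_all add: j_def path_image_join)
  have "path_image j \<inter> path_image (Q e) \<subseteq> {y e}"
    unfolding img using int PQ[OF e] by auto
  then have "arc (j +++ reversepath (Q e))"
    using j img(2) arc_Q[OF e] fin by (intro arc_join) (auto simp: arc_reversepath)
  moreover have "path_image (j +++ reversepath (Q e)) = curve e"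
    using fin img by (simp add: path_image_join curve_def)
  ultimately show ?thesis by blast
qed

lemma compact_curve: "e \<in> E \<Longrightarrow> compact (curve e)"
  using curve_arc arc_imp_path compact_path_image by metis

lemma connected_compl_arc: "arc g \<Longrightarrow> connected (- path_image g :: complex set)"
  by (rule connected_arc_complement) simp_all

text \<open>Two curves share at most one vertex because the graph is simple; this is where parallel edges would break
  Euler's inequality.\<close>

lemma connected_two: "M \<subseteq> E \<Longrightarrow> card M \<le> 2 \<Longrightarrow> connected (- (\<Union>e\<in>M. curve e))"
proof -
  assume M: "M \<subseteq> E" "card M \<le> 2"
  have one: "connected (- curve e)" if "e \<in> E" for e
    using curve_arc[OF that] connected_compl_arc by metis
  have fin: "finite M" using M finE finite_subset by blast
  consider "card M = 0" | "card M = 1" | "card M = 2" using M(2) by linarith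
  then show ?thesis
  proof cases
    case 1
    then show ?thesis using fin by (simp add: connected_UNIV)
  next
    case 2
    then obtain e where "M = {e}" by (rule card_1_singletonE)
    then show ?thesis using one M by simp
  next
    case 3
    then obtain e f where ef: "M = {e, f}" "e \<noteq> f" by (meson card_2_iff)
    have e: "e \<in> E" "f \<in> E" using M ef by auto
    have "curve e \<inter> curve f \<subseteq> {a e, b e} \<inter> {a f, b f}"
      using curve_curve[OF e ef(2)] curve_V[OF e(1)] curve_V[OF e(2)] by blast
    moreover have "{a e, b e} \<noteq> {a f, b f}" using simple[OF e ef(2)] .
    ultimately have "\<exists>v. curve e \<inter> curve f \<subseteq> {v}"
      by (cases "a e = a f"; cases "a e = b f"; cases "b e = a f"; cases "b e = b f") auto
    then have "connected (curve e \<inter> curve f)"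
      by (metis subset_singletonD connected_empty connected_sing)
    then have "connected (- (curve e \<union> curve f))"
      using one e compact_curve by (intro Janiszewski_connected) (auto simp: compact_imp_closed)
    then show ?thesis using ef by simp
  qed
qed

text \<open>At most two chords cannot close a cycle. Starting from their full curves, the remaining
  vertices and then the pendant pieces \<open>P e\<close> and \<open>Q e\<close> of the other edges are attached, each at one
  point.\<close>

lemma connected_complement_few_chords:
  assumes M: "M \<subseteq> E" "card M \<le> 2"
  shows "connected (- X M)"
proof -
  define S where "S = (\<Union>e\<in>M. curve e)"
  define S' where "S' = S \<union> \<Union>((\<lambda>v. {v}) ` V)"
  define F where "F = (\<lambda>e. path_image (P e)) ` E \<union> (\<lambda>e. path_image (Q e)) ` E"
  have finM: "finite M" using M finE finite_subset by blast
  have S: "compact S" "connected (- S)"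
    unfolding S_def using M finM connected_two compact_curve by (auto intro!: compact_UN)
  have S': "connected (- S')"
    unfolding S'_def
  proof (rule connected_complement_Un_family[OF S])
    fix T F' assume "T \<in> (\<lambda>v. {v}) ` V"
    then obtain v where "T = {v}" by auto
    then show "connected ((S \<union> \<Union>F') \<inter> T)"
      by (cases "v \<in> S \<union> \<Union>F'") auto
  qed (use finV in \<open>auto simp: connected_punctured_universe\<close>)
  have Vsub: "V \<subseteq> S'" by (auto simp: S'_def)
  have cS': "compact S'"
    using S(1) finV by (auto simp: S'_def intro: compact_Un finite_imp_compact)
  have "connected (- (S' \<union> \<Union>F))"
  proof (rule connected_complement_Un_family[OF cS' S'])
    show "finite F" using finE by (simp add: F_def)
    show "compact T \<and> connected (- T)" if "T \<in> F" for T
      using that arc_P arc_Q connected_compl_arc compact_pieces unfolding F_def by auto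
    fix T F' assume T: "T \<in> F" "F' \<subseteq> F" "T \<notin> F'"
    obtain e where e: "e \<in> E" "T = path_image (P e) \<or> T = path_image (Q e)"
      using T(1) by (auto simp: F_def)
    define v where "v = (if T = path_image (P e) then a e else b e)"
    have v: "v \<in> T" "v \<in> V" "T \<inter> V \<subseteq> {v}"
      using e ends[OF e(1)] ends_V[OF e(1)] curve_V[OF e(1)] PQ[OF e(1)]
      unfolding v_def curve_def by auto
    have Tc: "T \<subseteq> curve e" using e unfolding curve_def by auto
    have oth: "U \<inter> T \<subseteq> {v}" if U: "U \<in> F'" for U
    proof -
      obtain f where f: "f \<in> E" "U = path_image (P f) \<or> U = path_image (Q f)"
        using U T(2) unfolding F_def by blast
      show ?thesis
      proof (cases "f = e")
        case True
        then have "U \<inter> T = {}" using f e U T(3) PQ[OF e(1)] by auto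
        then show ?thesis by simp
      next
        case False
        have "U \<subseteq> curve f" using f unfolding curve_def by auto
        then show ?thesis using curve_curve[OF f(1) e(1) False] v(3) Tc by blast
      qed
    qed
    show "connected ((S' \<union> \<Union>F') \<inter> T)"
    proof (cases "e \<in> M")
      case True
      then have "T \<subseteq> S'" using Tc by (auto simp: S'_def S_def)
      then have "(S' \<union> \<Union>F') \<inter> T = T" by auto
      moreover have "connected T"
        using e arc_P arc_Q by (auto simp: arc_imp_path connected_path_image)
      ultimately show ?thesis by simp
    next
      case False
      have "S \<inter> T \<subseteq> V"
        using curve_curve[OF _ e(1)] M(1) Tc False unfolding S_def by blast
      then have "S' \<inter> T \<subseteq> {v}" using v(3) by (auto simp: S'_def)
      then have "(S' \<union> \<Union>F') \<inter> T = {v}" using oth v Vsub by blast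
      then show ?thesis by simp
    qed
  qed
  moreover have "S' \<union> \<Union>F = X M"
    using M(1) unfolding S'_def S_def F_def X_def K_def curve_def by auto
  ultimately show ?thesis by simp
qed

text \<open>Points in pairwise different faces. A finite set of such points stands for the number of faces, so that
  it need not be known in advance that there are finitely many of them.\<close>

definition sep where
  "sep M A \<longleftrightarrow> (\<forall>p\<in>A. \<forall>q\<in>A. p \<noteq> q \<longrightarrow> \<not> connected_component (- X M) p q)"

definition reach where "reach M = {(u, v). u \<in> V \<and> v \<in> V \<and> path_component (X M) u v}"

lemma V_X: "V \<subseteq> X M"
  by (auto simp: X_def K_def)

lemma equiv_reach: "equiv V (reach M)"
proof (rule equivI)
  show "refl_on V (reach M)"
    using V_X by (auto simp: refl_on_def reach_def intro: path_component_refl)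
  show "sym (reach M)" by (auto simp: sym_def reach_def intro: path_component_sym)
  show "trans (reach M)" by (auto simp: trans_def reach_def intro: path_component_trans)
qed (auto simp: reach_def)

lemma path_component_pieces:
  assumes "e \<in> E"
  shows "path_component (X M) (a e) (x e)" "path_component (X M) (b e) (y e)"
proof -
  have "path_image (P e) \<subseteq> X M" "path_image (Q e) \<subseteq> X M"
    using assms by (auto simp: X_def K_def)
  then show "path_component (X M) (a e) (x e)" "path_component (X M) (b e) (y e)"
    unfolding path_component_def x_def y_def
    using arc_imp_path[OF arc_P[OF assms]] arc_imp_path[OF arc_Q[OF assms]]
      start_P[OF assms] start_Q[OF assms] by blast+
qed

text \<open>The lower bound for the number of faces in Euler's formula, by induction on the set \<open>M\<close> of chords. A new
  chord either joins two components, or it has its tips in one component and then splits the face it lies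
  in. In the second case at most one point of the old set lies in that face, and it can reach only one of the two
  half discs, so a point of the other one can be added. Points are kept off the full drawing, such that later chords
  do not hit them.\<close>

lemma exists_separated_points:
  assumes "M \<subseteq> E"
  shows "\<exists>A. finite A \<and> A \<inter> X E = {} \<and> sep M A \<and>
     card M + card (V // reach M) \<le> card V + card A"
  using finite_subset[OF assms finE] assms
proof (induction M rule: finite_induct)
  case empty
  have "V // reach {} = (\<lambda>v. reach {} `` {v}) ` V" by (auto simp: quotient_def)
  then have "card (V // reach {}) \<le> card V" by (simp add: card_image_le finV)
  then show ?case by (intro exI[of _ "{}"]) (auto simp: sep_def)
next
  case (insert e M)
  then obtain A where A: "finite A" "A \<inter> X E = {}" "sep M A"
    "card M + card (V // reach M) \<le> card V + card A" by auto
  have e: "e \<in> E" "M \<subseteq> E" "insert e M \<subseteq> E" using insert.prems by auto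
  have mono: "connected_component (- X (insert e M)) p q \<Longrightarrow> connected_component (- X M) p q" for p q
    by (rule connected_component_of_subset) (use X_mono[of M "insert e M"] in auto)
  have sepA: "sep (insert e M) A" using A(3) mono by (auto simp: sep_def)
  have sub: "reach M \<subseteq> reach (insert e M)"
    using path_component_of_subset[OF X_mono[of M "insert e M"]] by (auto simp: reach_def)
  note q = card_quotient_mono[OF finV equiv_reach equiv_reach sub]
  show ?case
  proof (cases "path_component (X M) (a e) (b e)")
    case False
    have "path_component (X (insert e M)) (x e) (y e)"
      unfolding path_component_def
      by (intro exI[of _ "linepath (x e) (y e)"]) (auto simp: X_def chord_def)
    then have "path_component (X (insert e M)) (a e) (b e)"
      using path_component_pieces[OF e(1)] by (meson path_component_sym path_component_trans)
    then have "reach M \<noteq> reach (insert e M)"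
      using False ends_V[OF e(1)] by (auto simp: reach_def)
    then show ?thesis using A sepA q(2) insert.hyps by (intro exI[of _ A]) auto
  next
    case True
    then have tipcon: "path_component (X M) (x e) (y e)"
      using path_component_pieces[OF e(1)] by (meson path_component_sym path_component_trans)
    obtain h k where hk: "h \<in> half e True" "k \<in> half e False"
      using half_nonempty[OF e(1)] by blast
    have nsep: "\<not> connected_component (- X (insert e M)) h k"
      by (rule halves_separated[OF e(1,2) insert.hyps(2) tipcon hk])
    have disc: "ball (m e) (r e) \<subseteq> - X M"
      using disc_X[OF e(1,2)] insert.hyps(2) by auto
    have ball_con: "connected_component (- X M) u v"
      if "u \<in> ball (m e) (r e)" "v \<in> ball (m e) (r e)" for u v
      unfolding connected_component_def using that disc by (meson connected_ball)
    have "\<exists>z s. z \<in> half e s \<and> (\<forall>p\<in>A. \<not> connected_component (- X (insert e M)) z p)"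
    proof (rule ccontr)
      assume "\<not> ?thesis"
      then obtain p p' where p: "p \<in> A" "connected_component (- X (insert e M)) h p"
        "p' \<in> A" "connected_component (- X (insert e M)) k p'"
        using hk by metis
      have "connected_component (- X M) h k" using ball_con hk by (auto simp: half_def)
      then have "connected_component (- X M) p p'"
        using mono[OF p(2)] mono[OF p(4)] by (meson connected_component_sym connected_component_trans)
      then have "p = p'" using A(3) p by (auto simp: sep_def)
      then show False
        using p nsep by (meson connected_component_sym connected_component_trans)
    qed
    then obtain z s where z: "z \<in> half e s" "\<And>p. p \<in> A \<Longrightarrow> \<not> connected_component (- X (insert e M)) z p"
      by blast
    have zE: "z \<notin> X E" using half_X[OF e(1) subset_refl] z(1) by auto
    then have "z \<notin> X (insert e M)" using X_mono[OF e(3)] by auto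
    then have zA: "z \<notin> A" using z(2) connected_component_refl[of z "- X (insert e M)"] by blast
    have "sep (insert e M) (insert z A)"
      using sepA z(2) unfolding sep_def by (metis connected_component_sym insertE)
    moreover have "card (insert e M) + card (V // reach (insert e M)) \<le> card V + card (insert z A)"
      using q(1) A(1,4) zA insert.hyps by simp
    ultimately show ?thesis using A zE by (intro exI[of _ "insert z A"]) auto
  qed
qed

text \<open>If a face touches only the chords in a set \<open>M\<close> of at most two, its frontier lies in \<open>X M\<close>. As \<open>X M\<close> does
  not separate the plane, the face would be the whole complement of \<open>X M\<close> and contain the midpoint of a third chord.\<close>

lemma face_meets_three_discs:
  assumes p: "p \<notin> X E" and E3: "card E \<ge> 3"
  shows "3 \<le> card {e \<in> E. \<exists>s. \<forall>h\<in>half e s. connected_component (- X E) p h}"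
proof (rule ccontr)
  define M where "M = {e \<in> E. \<exists>s. \<forall>h\<in>half e s. connected_component (- X E) p h}"
  define f where "f = connected_component_set (- X E) p"
  assume "\<not> 3 \<le> card {e \<in> E. \<exists>s. \<forall>h\<in>half e s. connected_component (- X E) p h}"
  then have M: "M \<subseteq> E" "card M \<le> 2" by (auto simp: M_def)
  note con = connected_complement_few_chords[OF M]
  have pf: "p \<in> f" using p by (auto simp: f_def connected_component_refl)
  have fsub: "f \<subseteq> - X E" unfolding f_def by (rule connected_component_subset)
  have XME: "X M \<subseteq> X E" by (rule X_mono[OF M(1)])
  obtain e0 where e0: "e0 \<in> E" "e0 \<notin> M"
  proof -
    have "M \<noteq> E" using M(2) E3 by auto
    then show ?thesis using that M(1) by blast
  qed
  have "mid e0 \<in> chord e0"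
    using mid[OF e0(1)] segment_open_subset_closed unfolding chord_def by blast
  then have "mid e0 \<in> X E" using e0(1) by (auto simp: X_def)
  moreover have "mid e0 \<notin> X M"
  proof -
    have "ball (m e0) (r e0) \<inter> X M = {}"
      unfolding disc_X[OF e0(1) M(1)] if_not_P[OF e0(2)] ..
    then show ?thesis using mid[OF e0(1)] open_chord_disc[OF e0(1)] by blast
  qed
  ultimately have "mid e0 \<in> - X M - f" using fsub by (metis ComplD ComplI DiffI subsetD)
  then have "- X M - f \<noteq> {}" by (metis emptyE)
  moreover have "- X M \<inter> f \<noteq> {}"
  proof -
    have "p \<in> - X M \<inter> f" using pf p XME by (metis ComplI IntI subsetD)
    then show ?thesis by (metis emptyE)
  qed
  ultimately obtain w where w: "w \<in> frontier f" "w \<notin> X M"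
    using connected_Int_frontier[OF con, of f] by (metis ComplD IntE all_not_in_conv)
  have "frontier f \<subseteq> frontier (X E)"
    using frontier_of_connected_component_subset[of "- X E" p] by (simp add: f_def frontier_complement)
  also have "\<dots> \<subseteq> X E"
    using compact_X[of E] by (simp add: compact_imp_closed frontier_subset_closed)
  finally have "w \<in> X E" using w(1) by auto
  then obtain e where e: "e \<in> E" "e \<notin> M" "w \<in> chord e" "w \<notin> K"
    using w(2) unfolding X_def by blast
  have "x e \<in> K" "y e \<in> K" using ends[OF e(1)] e(1) unfolding K_def by auto
  then have "w \<in> open_segment (x e) (y e)"
    using e(3,4) unfolding chord_def closed_segment_eq_open by auto
  then have "w \<in> ball (m e) (r e)" using open_chord_disc[OF e(1)] by auto
  moreover have "w \<in> closure f" using w(1) by (simp add: frontier_def)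
  ultimately obtain z where z: "z \<in> f" "z \<in> ball (m e) (r e)"
    using closure_iff_nhds_not_empty[of w f] open_ball by blast
  have "z \<notin> open_segment (x e) (y e)"
    using z(1) fsub e(1) segment_open_subset_closed[of "x e" "y e"] unfolding X_def chord_def by blast
  then obtain s where s: "z \<in> half e s" using disc_cases[OF e(1) z(2)] by blast
  have "connected_component (- X E) p h" if "h \<in> half e s" for h
  proof -
    have "connected_component (- X E) z h"
      unfolding connected_component_def
      using half_X[OF e(1) subset_refl, of s] s that convex_connected[OF convex_half[of e s]] by blast
    then show ?thesis using z(1) connected_component_trans unfolding f_def by fastforce
  qed
  then show False using e(1,2) unfolding M_def by blast
qed

text \<open>Double counting of incidences between faces and chords: for \<open>F\<close> points in different faces, \<open>3 F \<le> 2 |E|\<close>.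
  On the other hand, \<open>exists_separated_points\<close> provides \<open>F\<close> such points with \<open>|E| \<le> |V| + F\<close>.\<close>

theorem card_edges_le: "card E \<le> 3 * card V"
proof (cases "card E \<ge> 3")
  case False
  show ?thesis
  proof (cases "E = {}")
    case False
    then obtain e where "e \<in> E" by auto
    then have "{a e, b e} \<subseteq> V" "a e \<noteq> b e" using ends_V by auto
    then have "2 \<le> card V" using card_mono[OF finV, of "{a e, b e}"] by simp
    then show ?thesis using \<open>\<not> card E \<ge> 3\<close> by simp
  qed simp
next
  case True
  obtain A where A: "finite A" "A \<inter> X E = {}" "sep E A"
     "card E + card (V // reach E) \<le> card V + card A"
    using exists_separated_points[OF subset_refl] by blast
  define I where "I p = {e \<in> E. \<exists>s. \<forall>h\<in>half e s. connected_component (- X E) p h}" for p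
  have "3 * card A = (\<Sum>p\<in>A. 3)" by simp
  also have "\<dots> \<le> (\<Sum>p\<in>A. card (I p))"
    using face_meets_three_discs[OF _ True] A(2) unfolding I_def by (intro sum_mono) auto
  also have "\<dots> = (\<Sum>p\<in>A. \<Sum>e\<in>E. if e \<in> I p then 1 else 0)"
    by (intro sum.cong refl) (simp add: I_def finE flip: sum.inter_filter)
  also have "\<dots> = (\<Sum>e\<in>E. \<Sum>p\<in>A. if e \<in> I p then 1 else 0)"
    by (rule sum.swap)
  also have "\<dots> = (\<Sum>e\<in>E. card {p\<in>A. e \<in> I p})"
    by (intro sum.cong refl) (simp add: A(1) flip: sum.inter_filter)
  also have "\<dots> \<le> (\<Sum>e\<in>E. 2)"
  proof (rule sum_mono)
    fix e assume e: "e \<in> E"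
    have "\<forall>p\<in>{p\<in>A. e \<in> I p}. \<exists>s. \<forall>h\<in>half e s. connected_component (- X E) p h"
      by (auto simp: I_def)
    then obtain s where s: "\<And>p h. p \<in> A \<Longrightarrow> e \<in> I p \<Longrightarrow> h \<in> half e (s p) \<Longrightarrow> connected_component (- X E) p h"
      by (metis (mono_tags, lifting) mem_Collect_eq)
    have "inj_on s {p\<in>A. e \<in> I p}"
    proof (rule inj_onI, rule ccontr)
      fix p q assume pq: "p \<in> {p\<in>A. e \<in> I p}" "q \<in> {p\<in>A. e \<in> I p}" "s p = s q" "p \<noteq> q"
      obtain h where h: "h \<in> half e (s p)" using half_nonempty[OF e] by blast
      have "connected_component (- X E) p h" "connected_component (- X E) q h"
        using s[of p h] s[of q h] pq h by auto
      then have "connected_component (- X E) p q"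
        by (meson connected_component_sym connected_component_trans)
      then show False using A(3) pq by (auto simp: sep_def)
    qed
    then have "card {p\<in>A. e \<in> I p} = card (s ` {p\<in>A. e \<in> I p})" by (simp add: card_image)
    also have "\<dots> \<le> card (UNIV :: bool set)" by (intro card_mono) auto
    finally show "card {p\<in>A. e \<in> I p} \<le> 2" by simp
  qed
  finally have "3 * card A \<le> 2 * card E" by simp
  then show ?thesis using A(4) by linarith
qed

end

section \<open>Euler's inequality for plane graphs\<close>

text \<open>The initial part of the arc up to its first point in the disc.\<close>

lemma arc_to_disc:
  fixes g :: "real \<Rightarrow> complex"
  assumes g: "arc g" "pathfinish g = c" "pathstart g \<notin> cball c r" and r: "r > 0"
  shows "\<exists>P. arc P \<and> pathstart P = pathstart g \<and> path_image P \<subseteq> path_image g \<and>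
     path_image P \<inter> cball c r = {pathfinish P} \<and> dist c (pathfinish P) = r"
proof -
  have "pathstart g \<in> closure (- ball c r)" "pathfinish g \<notin> - ball c r"
    using g r closure_subset[of "- ball c r"] by auto
  then obtain u where u: "0 \<le> u" "u \<le> 1" "g u \<in> frontier (- ball c r)"
      "path_image (subpath 0 u g) - {g u} \<subseteq> interior (- ball c r)"
    using subpath_to_frontier[OF arc_imp_path[OF g(1)]] by metis
  have gu: "dist c (g u) = r"
    using u(3) r by (simp add: frontier_complement)
  have int: "interior (- ball c r) = - cball c r"
    using r by (simp add: interior_complement)
  have "u \<noteq> 0"
    using gu g(3) by (auto simp: pathstart_def)
  then have "arc (subpath 0 u g)"
    using g(1) u(1,2) by (intro arc_subpath_arc) auto
  moreover have "path_image (subpath 0 u g) \<subseteq> path_image g"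
    using u g(1) by (intro path_image_subpath_subset) (auto simp: arc_imp_path)
  moreover have "pathfinish (subpath 0 u g) = g u" "pathstart (subpath 0 u g) = pathstart g"
    by (simp_all add: pathstart_def[of g])
  moreover have "path_image (subpath 0 u g) \<inter> cball c r = {g u}"
  proof -
    have "g u \<in> path_image (subpath 0 u g)"
      by (metis calculation(3) pathfinish_in_path_image)
    then show ?thesis using u(4) gu unfolding int by auto
  qed
  ultimately show ?thesis using gu by metis
qed

text \<open>The arc is followed from both ends until it first meets the disc. The two pieces lie on different sides of
  the parameter \<open>1/2\<close>, so they could meet in the centre of the disc only, which neither reaches.\<close>

lemma cut_arc_at_disc:
  fixes g :: "real \<Rightarrow> complex"
  assumes g: "arc g" and r: "r > 0" and ends: "{pathstart g, pathfinish g} \<inter> cball (g (1/2)) r = {}"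
  shows "\<exists>P Q. arc P \<and> arc Q \<and> pathstart P = pathstart g \<and> pathstart Q = pathfinish g \<and>
     path_image P \<subseteq> path_image g \<and> path_image Q \<subseteq> path_image g \<and>
     path_image P \<inter> path_image Q = {} \<and>
     path_image P \<inter> cball (g (1/2)) r = {pathfinish P} \<and>
     path_image Q \<inter> cball (g (1/2)) r = {pathfinish Q} \<and>
     dist (g (1/2)) (pathfinish P) = r \<and> dist (g (1/2)) (pathfinish Q) = r"
proof -
  let ?c = "g (1/2)"
  have arcs: "arc (subpath 0 (1/2) g)" "arc (subpath 1 (1/2) g)"
    using g by (auto intro!: arc_subpath_arc)
  obtain P where P: "arc P" "pathstart P = pathstart g" "path_image P \<subseteq> path_image (subpath 0 (1/2) g)"
      "path_image P \<inter> cball ?c r = {pathfinish P}" "dist ?c (pathfinish P) = r"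
    using arc_to_disc[OF arcs(1) _ _ r, of ?c] ends by (auto simp: pathstart_def[of g])
  obtain Q where Q: "arc Q" "pathstart Q = pathfinish g" "path_image Q \<subseteq> path_image (subpath 1 (1/2) g)"
      "path_image Q \<inter> cball ?c r = {pathfinish Q}" "dist ?c (pathfinish Q) = r"
    using arc_to_disc[OF arcs(2) _ _ r, of ?c] ends by (auto simp: pathfinish_def[of g])
  have inj: "inj_on g {0..1}" using g by (simp add: arc_def)
  have "path_image (subpath 0 (1/2) g) \<inter> path_image (subpath 1 (1/2) g) \<subseteq> {?c}"
  proof
    fix z assume "z \<in> path_image (subpath 0 (1/2) g) \<inter> path_image (subpath 1 (1/2) g)"
    then have im: "z \<in> g ` {0..1/2}" "z \<in> g ` {1/2..1}"
      by (simp_all add: path_image_subpath)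
    from im(1) obtain s where s: "z = g s" "s \<in> {0..1/2}" by (rule imageE)
    from im(2) obtain t where t: "z = g t" "t \<in> {1/2..1}" by (rule imageE)
    have "g s = g t" using s t by simp
    moreover have "s \<in> {0..1}" "t \<in> {0..1}" using s t by simp_all
    ultimately have "s = t" by (rule inj_onD[OF inj])
    then have "s = 1/2" using s(2) t(2) by simp
    then show "z \<in> {?c}" unfolding s(1) \<open>s = 1/2\<close> by simp
  qed
  moreover have "?c \<notin> path_image P"
  proof
    assume "?c \<in> path_image P"
    then have "?c \<in> path_image P \<inter> cball ?c r" using r by simp
    then show False using P(4,5) r by auto
  qed
  ultimately have "path_image P \<inter> path_image Q = {}" using P(3) Q(3) by blast
  moreover have "path_image (subpath 0 (1/2) g) \<subseteq> path_image g"
      "path_image (subpath 1 (1/2) g) \<subseteq> path_image g"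
    by (simp_all add: path_image_subpath_subset)
  then have "path_image P \<subseteq> path_image g" "path_image Q \<subseteq> path_image g"
    using order_trans[OF P(3)] order_trans[OF Q(3)] by simp_all
  ultimately show ?thesis using P Q
    by (intro exI[of _ P] exI[of _ Q] conjI)
qed

lemma isolating_discs:
  fixes c :: "'e \<Rightarrow> complex"
  assumes "\<And>e. e \<in> E \<Longrightarrow> closed (Z e)" and "\<And>e. e \<in> E \<Longrightarrow> c e \<notin> Z e"
    and "\<And>e f. e \<in> E \<Longrightarrow> f \<in> E \<Longrightarrow> e \<noteq> f \<Longrightarrow> c f \<in> Z e"
  shows "\<exists>r. (\<forall>e\<in>E. r e > 0 \<and> cball (c e) (r e) \<inter> Z e = {}) \<and>
    (\<forall>e\<in>E. \<forall>f\<in>E. e \<noteq> f \<longrightarrow> cball (c e) (r e) \<inter> cball (c f) (r f) = {})"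
proof -
  have "\<exists>\<rho>>0. cball (c e) \<rho> \<inter> Z e = {}" if e: "e \<in> E" for e
  proof -
    have "open (- Z e)" "c e \<in> - Z e" using assms(1,2)[OF e] by auto
    then obtain \<rho> where "\<rho> > 0" "cball (c e) \<rho> \<subseteq> - Z e"
      using open_contains_cball by meson
    then show ?thesis by blast
  qed
  then obtain \<rho> where \<rho>: "\<And>e. e \<in> E \<Longrightarrow> \<rho> e > 0 \<and> cball (c e) (\<rho> e) \<inter> Z e = {}" by metis
  show ?thesis
  proof (intro exI[of _ "\<lambda>e. \<rho> e / 2"] conjI ballI impI)
    show "\<rho> e / 2 > 0" if "e \<in> E" for e using \<rho>[OF that] by simp
    show "cball (c e) (\<rho> e / 2) \<inter> Z e = {}" if "e \<in> E" for e
    proof -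
      have "cball (c e) (\<rho> e / 2) \<subseteq> cball (c e) (\<rho> e)" using \<rho>[OF that] by (intro subset_cball) simp
      then show ?thesis using \<rho>[OF that] by blast
    qed
    fix e f assume ef: "e \<in> E" "f \<in> E" "e \<noteq> f"
    have "c f \<notin> cball (c e) (\<rho> e)" "c e \<notin> cball (c f) (\<rho> f)"
      using \<rho> assms(3) ef by blast+
    then have d: "dist (c e) (c f) > \<rho> e" "dist (c e) (c f) > \<rho> f"
      by (auto simp: dist_commute)
    \<comment> \<open>halving the radii makes the discs disjoint, because each centre is outside the other full disc\<close>
    show "cball (c e) (\<rho> e / 2) \<inter> cball (c f) (\<rho> f / 2) = {}"
    proof (rule ccontr)
      assume "\<not> ?thesis"
      then obtain z where "dist (c e) z \<le> \<rho> e / 2" "dist (c f) z \<le> \<rho> f / 2" by auto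
      then show False using d dist_triangle2[of "c e" "c f" z] by (simp add: dist_commute)
    qed
  qed
qed

text \<open>Around the midpoint of each arc, a disc is chosen that avoids the chosen vertices, the other arcs and the other
  discs. The part of the arc between its first and last visit to the disc is replaced by a chord.\<close>

theorem plane_graph_card_edges_le:
  assumes G: "is_plane_graph G" and S: "finite S" "S \<subseteq> vertices G"
  shows "card {e \<in> edges G. e \<subseteq> S} \<le> 3 * card S"
proof -
  define E where "E = {e \<in> edges G. e \<subseteq> S}"
  define \<gamma> where "\<gamma> = arc_of G"
  define V where "V = pos G ` S"
  have inj: "inj_on (pos G) (vertices G)" and sg: "simple_graph G"
    and arcs: "\<forall>e\<in>edges G. arc (\<gamma> e) \<and> {pathstart (\<gamma> e), pathfinish (\<gamma> e)} = pos G ` e"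
    and verts: "\<forall>e\<in>edges G. path_image (\<gamma> e) \<inter> pos G ` vertices G = pos G ` e"
    and crosses: "\<forall>e\<in>edges G. \<forall>f\<in>edges G. e \<noteq> f \<longrightarrow>
        path_image (\<gamma> e) \<inter> path_image (\<gamma> f) = pos G ` (e \<inter> f)"
    using G unfolding is_plane_graph_def \<gamma>_def by - (elim conjE, assumption)+
  note arc = bspec[OF arcs] and vert = bspec[OF verts] and cross = crosses[rule_format]
  have ES: "e \<in> edges G" "e \<subseteq> S" if "e \<in> E" for e
    using that by (auto simp: E_def)
  have finE: "finite E"
    by (rule finite_subset[of _ "Pow S"]) (use S(1) in \<open>auto simp: E_def\<close>)
  have finV: "finite V" using S by (simp add: V_def)
  have vertV: "path_image (\<gamma> e) \<inter> V = pos G ` e" if "e \<in> E" for e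
  proof -
    have "pos G ` e \<subseteq> V" using ES(2)[OF that] by (auto simp: V_def)
    moreover have "V \<subseteq> pos G ` vertices G" using S by (auto simp: V_def)
    ultimately have "path_image (\<gamma> e) \<inter> V = (path_image (\<gamma> e) \<inter> pos G ` vertices G) \<inter> V"
      "pos G ` e \<inter> V = pos G ` e" by auto
    then show ?thesis using vert[OF ES(1)[OF that]] by simp
  qed
  define c where "c e = \<gamma> e (1/2)" for e
  have c_in: "c e \<in> path_image (\<gamma> e)" for e
    by (auto simp: c_def path_image_def)
  have c_notin: "c e \<notin> pos G ` e" if "e \<in> edges G" for e
  proof -
    have "inj_on (\<gamma> e) {0..1}" using arc[OF that] by (simp add: arc_def)
    then have "c e \<noteq> pathstart (\<gamma> e)" "c e \<noteq> pathfinish (\<gamma> e)"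
      unfolding c_def pathstart_def pathfinish_def by (simp_all add: inj_on_eq_iff)
    then have "c e \<notin> {pathstart (\<gamma> e), pathfinish (\<gamma> e)}" by simp
    then show ?thesis using conjunct2[OF arc[OF that]] by simp
  qed
  define Z where "Z e = V \<union> (\<Union>f\<in>E - {e}. path_image (\<gamma> f))" for e
  have "closed (Z e)" for e
    unfolding Z_def using finE finV conjunct1[OF arc[OF ES(1)]]
    by (intro closed_Un closed_UN) (simp_all add: finite_imp_closed closed_path_image arc_imp_path)
  moreover have "c e \<notin> Z e" if e: "e \<in> E" for e
  proof
    assume "c e \<in> Z e"
    then consider "c e \<in> V" | f where "f \<in> E" "f \<noteq> e" "c e \<in> path_image (\<gamma> f)"
      by (auto simp: Z_def)
    then have "c e \<in> pos G ` e"
    proof cases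
      case 1
      then have "c e \<in> path_image (\<gamma> e) \<inter> V" using c_in by simp
      then show ?thesis using vertV[OF e] by simp
    next
      case 2
      then have "c e \<in> path_image (\<gamma> e) \<inter> path_image (\<gamma> f)" using c_in by simp
      then have "c e \<in> pos G ` (e \<inter> f)" using cross[OF ES(1)[OF e] ES(1)[OF 2(1)] 2(2)[symmetric]] by simp
      then show ?thesis by auto
    qed
    then show False using c_notin[OF ES(1)[OF e]] by simp
  qed
  moreover have "c f \<in> Z e" if "e \<in> E" "f \<in> E" "e \<noteq> f" for e f
    using that c_in by (auto simp: Z_def)
  ultimately have "\<exists>r. (\<forall>e\<in>E. r e > 0 \<and> cball (c e) (r e) \<inter> Z e = {}) \<and>
    (\<forall>e\<in>E. \<forall>f\<in>E. e \<noteq> f \<longrightarrow> cball (c e) (r e) \<inter> cball (c f) (r f) = {})"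
    by (intro isolating_discs) simp_all
  then obtain r where r0: "\<forall>e\<in>E. r e > 0 \<and> cball (c e) (r e) \<inter> Z e = {}"
    "\<forall>e\<in>E. \<forall>f\<in>E. e \<noteq> f \<longrightarrow> cball (c e) (r e) \<inter> cball (c f) (r f) = {}"
    by (elim exE conjE)
  have r: "e \<in> E \<Longrightarrow> r e > 0" "e \<in> E \<Longrightarrow> cball (c e) (r e) \<inter> Z e = {}"
    "e \<in> E \<Longrightarrow> f \<in> E \<Longrightarrow> e \<noteq> f \<Longrightarrow> cball (c e) (r e) \<inter> cball (c f) (r f) = {}" for e f
    using r0 by simp_all
  have "\<exists>P Q. arc P \<and> arc Q \<and> pathstart P = pathstart (\<gamma> e) \<and> pathstart Q = pathfinish (\<gamma> e) \<and>
     path_image P \<subseteq> path_image (\<gamma> e) \<and> path_image Q \<subseteq> path_image (\<gamma> e) \<and>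
     path_image P \<inter> path_image Q = {} \<and>
     path_image P \<inter> cball (c e) (r e) = {pathfinish P} \<and>
     path_image Q \<inter> cball (c e) (r e) = {pathfinish Q} \<and>
     dist (c e) (pathfinish P) = r e \<and> dist (c e) (pathfinish Q) = r e" if e: "e \<in> E" for e
    unfolding c_def
  proof (rule cut_arc_at_disc)
    show "arc (\<gamma> e)" using arc[OF ES(1)[OF e]] ..
    show "r e > 0" using r e by auto
    have "pos G ` e \<subseteq> Z e" using ES(2)[OF e] by (auto simp: V_def Z_def)
    then show "{pathstart (\<gamma> e), pathfinish (\<gamma> e)} \<inter> cball (\<gamma> e (1/2)) (r e) = {}"
      unfolding conjunct2[OF arc[OF ES(1)[OF e]]] using r(2)[OF e] unfolding c_def by blast
  qed
  then obtain P Q where PQ: "\<And>e. e \<in> E \<Longrightarrow> arc (P e) \<and> arc (Q e) \<and> pathstart (P e) = pathstart (\<gamma> e) \<and> pathstart (Q e) = pathfinish (\<gamma> e) \<and>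
     path_image (P e) \<subseteq> path_image (\<gamma> e) \<and> path_image (Q e) \<subseteq> path_image (\<gamma> e) \<and>
     path_image (P e) \<inter> path_image (Q e) = {} \<and>
     path_image (P e) \<inter> cball (c e) (r e) = {pathfinish (P e)} \<and>
     path_image (Q e) \<inter> cball (c e) (r e) = {pathfinish (Q e)} \<and>
     dist (c e) (pathfinish (P e)) = r e \<and> dist (c e) (pathfinish (Q e)) = r e"
    by metis
  define curve where "curve e = path_image (P e) \<union> closed_segment (pathfinish (P e)) (pathfinish (Q e)) \<union> path_image (Q e)" for e
  have curve_sub: "curve e \<subseteq> path_image (\<gamma> e) \<union> cball (c e) (r e)" if e: "e \<in> E" for e
  proof -
    have "closed_segment (pathfinish (P e)) (pathfinish (Q e)) \<subseteq> cball (c e) (r e)"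
      using PQ[OF e] by (intro closed_segment_subset) auto
    moreover have "path_image (P e) \<subseteq> path_image (\<gamma> e)" "path_image (Q e) \<subseteq> path_image (\<gamma> e)"
      using PQ[OF e] by simp_all
    ultimately show ?thesis unfolding curve_def by blast
  qed
  have disc_V: "cball (c e) (r e) \<inter> V = {}" if "e \<in> E" for e
    using r(2)[OF that] by (auto simp: Z_def)
  have disc_arc: "cball (c e) (r e) \<inter> path_image (\<gamma> f) = {}" if "e \<in> E" "f \<in> E" "e \<noteq> f" for e f
    using r(2)[OF that(1)] that by (auto simp: Z_def)
  have "chorded_drawing V E (\<lambda>e. pathstart (\<gamma> e)) (\<lambda>e. pathfinish (\<gamma> e)) P Q c r"
  proof
    fix e assume e: "e \<in> E"
    have "{pathstart (\<gamma> e), pathfinish (\<gamma> e)} \<subseteq> curve e"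
      using PQ[OF e] pathstart_in_path_image[of "P e"] pathstart_in_path_image[of "Q e"]
      unfolding curve_def by auto
    moreover have "{pathstart (\<gamma> e), pathfinish (\<gamma> e)} = path_image (\<gamma> e) \<inter> V"
      using conjunct2[OF arc[OF ES(1)[OF e]]] vertV[OF e] by simp
    ultimately have "curve e \<inter> V = {pathstart (\<gamma> e), pathfinish (\<gamma> e)}"
      using curve_sub[OF e] disc_V[OF e] by blast
    then show "(path_image (P e) \<union> closed_segment (pathfinish (P e)) (pathfinish (Q e)) \<union> path_image (Q e)) \<inter> V =
       {pathstart (\<gamma> e), pathfinish (\<gamma> e)}"
      by (simp add: curve_def)
  next
    fix e f assume ef: "e \<in> E" "f \<in> E" "e \<noteq> f"
    have "path_image (\<gamma> e) \<inter> path_image (\<gamma> f) \<subseteq> V"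
      unfolding cross[OF ES(1)[OF ef(1)] ES(1)[OF ef(2)] ef(3)] using ES(2)[OF ef(1)] by (auto simp: V_def)
    then have "curve e \<inter> curve f \<subseteq> V"
      using curve_sub[OF ef(1)] curve_sub[OF ef(2)] disc_arc[OF ef] disc_arc[OF ef(2,1)] r(3)[OF ef] ef(3)
      by blast
    then show "(path_image (P e) \<union> closed_segment (pathfinish (P e)) (pathfinish (Q e)) \<union> path_image (Q e)) \<inter>
      (path_image (P f) \<union> closed_segment (pathfinish (P f)) (pathfinish (Q f)) \<union> path_image (Q f)) \<subseteq> V"
      by (simp add: curve_def)
    have "pos G ` e \<noteq> pos G ` f"
    proof -
      have "e \<subseteq> vertices G" "f \<subseteq> vertices G"
        using sg ES(1)[OF ef(1)] ES(1)[OF ef(2)] unfolding simple_graph_def by blast+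
      then show ?thesis using inj_on_image_eq_iff[OF inj] ef(3) by simp
    qed
    then show "{pathstart (\<gamma> e), pathfinish (\<gamma> e)} \<noteq> {pathstart (\<gamma> f), pathfinish (\<gamma> f)}"
      using conjunct2[OF arc[OF ES(1)[OF ef(1)]]] conjunct2[OF arc[OF ES(1)[OF ef(2)]]] by simp
    have "cball (c e) (r e) \<inter> curve f = {}"
      using curve_sub[OF ef(2)] disc_arc[OF ef] r(3)[OF ef] by blast
    then show "cball (c e) (r e) \<inter> (path_image (P f) \<union> closed_segment (pathfinish (P f)) (pathfinish (Q f)) \<union> path_image (Q f)) = {}"
      by (simp add: curve_def)
  qed (use finV finE r PQ disc_V in auto)
  then have "card E \<le> 3 * card V" by (rule chorded_drawing.card_edges_le)
  also have "card V \<le> card S" unfolding V_def by (rule card_image_le[OF S(1)])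
  finally show ?thesis by (simp add: E_def)
qed

section \<open>The law of the random walk at a fixed time\<close>

primrec walk_law :: "'v graph \<Rightarrow> nat \<Rightarrow> 'v \<Rightarrow> 'v pmf" where
  "walk_law G 0 x = return_pmf x"
| "walk_law G (Suc n) x = bind_pmf (walk_law G n x) (\<lambda>y. pmf_of_set (neighbours G y))"

text \<open>Splitting off the first instead of the last step: in this form the probabilities of being at a fixed vertex
  \<open>z\<close> satisfy a recursion in the starting vertex.\<close>

lemma walk_law_Suc: "walk_law G (Suc n) x = bind_pmf (pmf_of_set (neighbours G x)) (walk_law G n)"
proof (induction n)
  case 0
  show ?case by (simp add: bind_return_pmf bind_return_pmf')
next
  case (Suc n)
  show ?case
    using Suc by (subst walk_law.simps(2), simp only: bind_assoc_pmf walk_law.simps(2))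
qed

lemma sets_PiM_coordinate:
  assumes "n \<in> I"
  shows "{\<omega> \<in> space (PiM I (\<lambda>_. count_space UNIV)). \<omega> n \<in> A} \<in> sets (PiM I (\<lambda>_. count_space UNIV))"
proof -
  let ?M = "PiM I (\<lambda>_. count_space UNIV)"
  have "(\<lambda>\<omega>. \<omega> n) -` A \<inter> space ?M \<in> sets ?M"
    by (rule measurable_sets[OF measurable_component_singleton[OF assms]]) simp
  moreover have "(\<lambda>\<omega>. \<omega> n) -` A \<inter> space ?M = {\<omega> \<in> space ?M. \<omega> n \<in> A}" by auto
  ultimately show ?thesis by simp
qed

text \<open>Step \<open>n\<close> is the last coordinate of a prefix of length \<open>n + 1\<close>. Its law is that of the prefix before, followed by the
  kernel, which depends on the latter's last coordinate only.\<close>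

lemma emeasure_trajectory_prefix:
  "emeasure (srw.C G x 0 (Suc n) (\<lambda>_. undefined)) {\<omega> \<in> space (PiM {0..<Suc n} (\<lambda>_. count_space UNIV)). \<omega> n \<in> A} =
    emeasure (walk_law G n x) A"
proof (induction n arbitrary: A)
  case 0
  let ?M = "\<lambda>n. PiM {0..<n} (\<lambda>_. count_space UNIV) :: (nat \<Rightarrow> 'a) measure"
  have u: "(\<lambda>_. undefined) \<in> space (?M 0)" by (simp add: space_PiM)
  have m: "{\<omega> \<in> space (?M (Suc 0)). \<omega> 0 \<in> A} \<in> sets (?M (Suc 0))"
    by (rule sets_PiM_coordinate) simp
  have "srw.C G x 0 (Suc 0) (\<lambda>_. undefined) = srw.eP G x 0 (\<lambda>_. undefined)"
    unfolding srw.C.simps add_0 by (rule bind_return[OF srw.measurable_eP u])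
  then have "emeasure (srw.C G x 0 (Suc 0) (\<lambda>_. undefined)) {\<omega> \<in> space (?M (Suc 0)). \<omega> 0 \<in> A} =
    emeasure (srw.eP G x 0 (\<lambda>_. undefined)) {\<omega> \<in> space (?M (Suc 0)). \<omega> 0 \<in> A}"
    by simp
  also have "\<dots> = emeasure (srw_kernel G x 0 (\<lambda>_. undefined)) A"
    by (subst srw.emeasure_eP[OF u m]) (auto intro!: arg_cong2[where f=emeasure] simp: space_PiM PiE_iff extensional_def)
  finally show ?case by simp
next
  case (Suc n)
  let ?M = "\<lambda>n. PiM {0..<n} (\<lambda>_. count_space UNIV) :: (nat \<Rightarrow> 'a) measure"
  let ?C = "srw.C G x 0 (Suc n) (\<lambda>_. undefined)"
  have u: "(\<lambda>_. undefined) \<in> space (?M 0)" by (simp add: space_PiM)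
  have sC: "space ?C = space (?M (Suc n))" "sets ?C = sets (?M (Suc n))"
    using srw.space_C[OF u, of G x "Suc n"] srw.sets_C[OF u, of G x "Suc n"] by simp_all
  have m: "{\<omega> \<in> space (?M (Suc (Suc n))). \<omega> (Suc n) \<in> A} \<in> sets (?M (Suc (Suc n)))"
    by (rule sets_PiM_coordinate) simp
  have proj: "(\<lambda>\<omega>. \<omega> n) \<in> measurable ?C (count_space UNIV)"
    unfolding measurable_cong_sets[OF sC(2) refl] by (rule measurable_component_singleton) simp
  have eP: "srw.eP G x (Suc n) \<in> measurable ?C (subprob_algebra (?M (Suc (Suc n))))"
    using srw.measurable_eP[of G x "Suc n"] measurable_cong_sets[OF sC(2) refl] by blast
  have ne: "space ?C \<noteq> {}" unfolding sC by (simp add: space_PiM PiE_eq_empty_iff)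
  have law: "distr ?C (count_space UNIV) (\<lambda>\<omega>. \<omega> n) = measure_pmf (walk_law G n x)"
  proof (rule measure_eqI)
    fix B :: "'a set" assume "B \<in> sets (distr ?C (count_space UNIV) (\<lambda>\<omega>. \<omega> n))"
    have "emeasure (distr ?C (count_space UNIV) (\<lambda>\<omega>. \<omega> n)) B = emeasure ?C ((\<lambda>\<omega>. \<omega> n) -` B \<inter> space ?C)"
      by (rule emeasure_distr[OF proj]) simp
    also have "(\<lambda>\<omega>. \<omega> n) -` B \<inter> space ?C = {\<omega> \<in> space (?M (Suc n)). \<omega> n \<in> B}"
      using sC by auto
    finally show "emeasure (distr ?C (count_space UNIV) (\<lambda>\<omega>. \<omega> n)) B = emeasure (walk_law G n x) B"
      using Suc.IH[of B] by simp
  qed simp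
  have "emeasure (srw.C G x 0 (Suc (Suc n)) (\<lambda>_. undefined)) {\<omega> \<in> space (?M (Suc (Suc n))). \<omega> (Suc n) \<in> A}
    = (\<integral>\<^sup>+ \<omega>. emeasure (srw.eP G x (Suc n) \<omega>) {\<omega> \<in> space (?M (Suc (Suc n))). \<omega> (Suc n) \<in> A} \<partial>?C)"
    using emeasure_bind[OF ne eP m] by simp
  also have "\<dots> = (\<integral>\<^sup>+ \<omega>. emeasure (pmf_of_set (neighbours G (\<omega> n))) A \<partial>?C)"
  proof (rule nn_integral_cong)
    fix \<omega> assume "\<omega> \<in> space ?C"
    then have \<omega>: "\<omega> \<in> space (?M (Suc n))" using sC by simp
    show "emeasure (srw.eP G x (Suc n) \<omega>) {\<omega> \<in> space (?M (Suc (Suc n))). \<omega> (Suc n) \<in> A} =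
      emeasure (pmf_of_set (neighbours G (\<omega> n))) A"
      using \<omega> by (subst srw.emeasure_eP[OF \<omega> m])
        (auto intro!: arg_cong2[where f=emeasure] simp: space_PiM PiE_iff extensional_def)
  qed
  also have "\<dots> = (\<integral>\<^sup>+ y. emeasure (pmf_of_set (neighbours G y)) A \<partial>distr ?C (count_space UNIV) (\<lambda>\<omega>. \<omega> n))"
    by (rule nn_integral_distr[OF proj, symmetric]) simp
  also have "\<dots> = emeasure (walk_law G (Suc n) x) A"
    unfolding law by (simp add: emeasure_bind_pmf)
  finally show ?case .
qed

lemma emeasure_simple_random_walk:
  "{\<omega> \<in> space (simple_random_walk G x). \<omega> n = y} \<in> sets (simple_random_walk G x)"
  "emeasure (simple_random_walk G x) {\<omega> \<in> space (simple_random_walk G x). \<omega> n = y} = pmf (walk_law G n x) y"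
proof -
  let ?M = "\<lambda>I. PiM I (\<lambda>_. count_space UNIV) :: (nat \<Rightarrow> 'a) measure"
  have sp: "space (simple_random_walk G x) = space (?M UNIV)"
    and se: "sets (simple_random_walk G x) = sets (?M UNIV)"
    by (simp_all add: simple_random_walk_def srw.PF.space_lim srw.PF.sets_lim)
  have "{\<omega> \<in> space (?M UNIV). \<omega> n = y} \<in> sets (?M UNIV)"
    using sets_PiM_coordinate[of n UNIV "{y}"] by simp
  then show "{\<omega> \<in> space (simple_random_walk G x). \<omega> n = y} \<in> sets (simple_random_walk G x)"
    by (simp add: sp se)
  let ?J = "{0..<Suc n}" and ?X = "{\<omega> \<in> space (?M {0..<Suc n}). \<omega> n \<in> {y}}"
  have X: "?X \<in> sets (?M ?J)" by (rule sets_PiM_coordinate) simp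
  have "{\<omega> \<in> space (simple_random_walk G x). \<omega> n = y} = srw.PF.emb UNIV ?J ?X"
    unfolding sp by (auto simp: prod_emb_def space_PiM)
  then have "emeasure (simple_random_walk G x) {\<omega> \<in> space (simple_random_walk G x). \<omega> n = y} =
     emeasure (srw.CI G x ?J) ?X"
    using srw.lim[OF _ X, of G x] by (simp add: simple_random_walk_def)
  also have "\<dots> = emeasure (srw.C G x 0 (Suc n) (\<lambda>_. undefined)) (srw.PF.emb ?J ?J ?X)"
    by (rule srw.emeasure_CI[OF subset_refl X])
  also have "srw.PF.emb ?J ?J ?X = ?X"
    by (rule prod_emb_id) (auto simp: space_PiM)
  also have "emeasure (srw.C G x 0 (Suc n) (\<lambda>_. undefined)) ?X = pmf (walk_law G n x) y"
    unfolding emeasure_trajectory_prefix by (rule emeasure_pmf_single)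
  finally show "emeasure (simple_random_walk G x) {\<omega> \<in> space (simple_random_walk G x). \<omega> n = y} = pmf (walk_law G n x) y" .
qed

lemma finite_visits_if_summable:
  assumes "summable (\<lambda>n. pmf (walk_law G n x) y)"
  shows "AE \<omega> in simple_random_walk G x. finite {n. \<omega> n = y}"
proof -
  let ?W = "simple_random_walk G x"
  let ?A = "\<lambda>n. {\<omega> \<in> space ?W. \<omega> n = y}"
  have "AE \<omega> in ?W. \<forall>\<^sub>F n in sequentially. \<omega> \<in> space ?W - ?A n"
  proof (rule borel_cantelli_AE1)
    show "?A n \<in> sets ?W" "emeasure ?W (?A n) < \<infinity>" for n
      using emeasure_simple_random_walk[of G x n y] by simp_all
    have "measure ?W (?A n) = pmf (walk_law G n x) y" for n
      by (simp add: measure_def emeasure_simple_random_walk(2))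
    then show "summable (\<lambda>n. measure ?W (?A n))" using assms by simp
  qed
  then show ?thesis
  proof eventually_elim
    case (elim \<omega>)
    then obtain N where "\<And>n. n \<ge> N \<Longrightarrow> \<omega> n \<noteq> y"
      unfolding eventually_sequentially by auto
    then have "{n. \<omega> n = y} \<subseteq> {..<N}" by (auto simp: not_less[symmetric])
    then show ?case by (rule finite_subset) simp
  qed
qed

section \<open>A Poincare inequality implies transience\<close>

lemma neighbours_sym: "y \<in> neighbours G x \<longleftrightarrow> x \<in> neighbours G y"
  by (simp add: neighbours_def insert_commute)

text \<open>The condition on \<open>W\<close> says that it contains the support of \<open>f\<close> and all neighbours of the support, so the double
  sum is the full Dirichlet energy of \<open>f\<close>, each edge being counted in both directions.\<close>

definition poincare :: "'v graph \<Rightarrow> real \<Rightarrow> bool" where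
  "poincare G c \<longleftrightarrow> (\<forall>f W. finite W \<and> W \<subseteq> vertices G \<and>
     (\<forall>x\<in>vertices G. f x \<noteq> 0 \<longrightarrow> x \<in> W \<and> neighbours G x \<subseteq> W) \<longrightarrow>
     (\<Sum>x\<in>W. (f x)\<^sup>2) \<le> c * (\<Sum>x\<in>W. \<Sum>y\<in>neighbours G x \<inter> W. (f x - f y :: real)\<^sup>2))"

text \<open>Summation by parts: the Dirichlet energy is \<open>2 \<langle>f, \<Delta> f\<rangle>\<close> with the graph Laplacian \<open>\<Delta>\<close>.\<close>

lemma dirichlet_form_parts:
  assumes "finite W"
  shows "(\<Sum>x\<in>W. \<Sum>y\<in>neighbours G x \<inter> W. (f x - f y :: real)\<^sup>2) =
    2 * (\<Sum>x\<in>W. \<Sum>y\<in>neighbours G x \<inter> W. f x * (f x - f y))"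
proof -
  have fil: "(\<Sum>y\<in>neighbours G x \<inter> W. h x y) = (\<Sum>y\<in>W. if y \<in> neighbours G x then h x y else 0)"
    for h :: "'a \<Rightarrow> 'a \<Rightarrow> real" and x
    using assms by (subst Int_commute) (rule sum.inter_restrict)
  have "(\<Sum>x\<in>W. \<Sum>y\<in>neighbours G x \<inter> W. f y * (f y - f x)) =
    (\<Sum>x\<in>W. \<Sum>y\<in>W. if y \<in> neighbours G x then f y * (f y - f x) else 0)"
    by (subst fil) simp
  also have "\<dots> = (\<Sum>y\<in>W. \<Sum>x\<in>W. if y \<in> neighbours G x then f y * (f y - f x) else 0)"
    by (rule sum.swap)
  also have "\<dots> = (\<Sum>x\<in>W. \<Sum>y\<in>W. if y \<in> neighbours G x then f x * (f x - f y) else 0)"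
    by (intro sum.cong refl) (simp add: neighbours_sym)
  also have "\<dots> = (\<Sum>x\<in>W. \<Sum>y\<in>neighbours G x \<inter> W. f x * (f x - f y))"
    by (subst fil) simp
  finally have swap: "(\<Sum>x\<in>W. \<Sum>y\<in>neighbours G x \<inter> W. f y * (f y - f x)) =
    (\<Sum>x\<in>W. \<Sum>y\<in>neighbours G x \<inter> W. f x * (f x - f y))" .
  have "(f x - f y)\<^sup>2 = f x * (f x - f y) + f y * (f y - f x)" for x y
    by (simp add: power2_eq_square algebra_simps)
  then show ?thesis using swap by (simp add: sum.distrib)
qed

text \<open>Let \<open>u = \<Sum>n<N. p\<^sub>n(\<cdot>, z)\<close>. By telescoping, \<open>\<Delta> u = deg \<cdot> (p\<^sub>0 - p\<^sub>N) \<le> deg \<cdot> p\<^sub>0\<close>, hence the energy of \<open>u\<close> is at most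
  \<open>2 deg(z) u(z)\<close>. With the Poincare inequality, \<open>u(z)\<^sup>2 \<le> \<Sum> u\<^sup>2 \<le> 2 c deg(z) u(z)\<close>, which bounds first
  \<open>u(z)\<close> and then every value of \<open>u\<close>, uniformly in \<open>N\<close>. So the Green function is finite.\<close>

theorem transient_if_poincare:
  assumes nb: "\<And>x. x \<in> vertices G \<Longrightarrow> finite (neighbours G x) \<and> neighbours G x \<noteq> {} \<and> neighbours G x \<subseteq> vertices G"
    and P: "poincare G c"
  shows "transient G"
  unfolding transient_def
proof (intro ballI finite_visits_if_summable)
  fix x z assume x: "x \<in> vertices G" and z: "z \<in> vertices G"
  define p where "p n y = pmf (walk_law G n y) z" for n y
  define u where "u N y = (\<Sum>n<N. p n y)" for N y
  \<comment> \<open>the balls around \<open>z\<close>, which contain the supports of the functions \<open>p n\<close>\<close>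
  define B where "B = rec_nat {z} (\<lambda>_ S. S \<union> (\<Union>y\<in>S. neighbours G y))"
  have B0: "B 0 = {z}" and BS: "B (Suc n) = B n \<union> (\<Union>y\<in>B n. neighbours G y)" for n
    by (simp_all add: B_def)
  have Bfin: "finite (B n) \<and> B n \<subseteq> vertices G" for n
  proof (induction n)
    case 0
    then show ?case using z by (simp add: B0)
  next
    case (Suc n)
    then show ?case using nb unfolding BS by blast
  qed
  have Bmono: "m \<le> n \<Longrightarrow> B m \<subseteq> B n" for m n
    by (rule lift_Suc_mono_le[of B]) (auto simp: BS)
  have p0: "p 0 y = (if y = z then 1 else 0)" for y
    by (simp add: p_def)
  have pS: "real (card (neighbours G y)) * p (Suc n) y = (\<Sum>w\<in>neighbours G y. p n w)"
    if "y \<in> vertices G" for n y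
    using nb[OF that] unfolding p_def walk_law_Suc by (simp add: pmf_bind_pmf_of_set)
  have pB: "y \<in> vertices G \<Longrightarrow> p n y \<noteq> 0 \<Longrightarrow> y \<in> B n" for n y
  proof (induction n arbitrary: y)
    case 0
    then show ?case by (auto simp: p0 B0 split: if_splits)
  next
    case (Suc n)
    have "(\<Sum>w\<in>neighbours G y. p n w) \<noteq> 0"
      using Suc.prems pS[OF Suc.prems(1), of n] nb[OF Suc.prems(1)] by (metis card_eq_0_iff mult_eq_0_iff of_nat_eq_0_iff)
    then obtain w where w: "w \<in> neighbours G y" "p n w \<noteq> 0" by (metis sum.neutral)
    then have "w \<in> B n" using Suc.IH nb[OF Suc.prems(1)] by blast
    then show ?case using w(1) neighbours_sym[of w G y] unfolding BS by blast
  qed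
  have p_nonneg: "p n y \<ge> 0" for n y by (simp add: p_def)
  have u_nonneg: "u N y \<ge> 0" for N y unfolding u_def by (intro sum_nonneg p_nonneg)
  define d where "d = real (card (neighbours G z))"
  define c' where "c' = max c 0"
  have bound: "u N y \<le> 2 * c' * d" if y: "y \<in> vertices G" for N y
  proof -
    let ?W = "B (Suc N)" and ?f = "u N"
    have supp: "w \<in> B N" if w: "w \<in> vertices G" "?f w \<noteq> 0" for w
    proof -
      obtain n where n: "n < N" "p n w \<noteq> 0"
        using w(2) unfolding u_def by (metis lessThan_iff sum.neutral)
      then show ?thesis using pB[OF w(1) n(2)] Bmono[of n N] by auto
    qed
    have supp': "\<forall>w\<in>vertices G. ?f w \<noteq> 0 \<longrightarrow> w \<in> ?W \<and> neighbours G w \<subseteq> ?W"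
      using supp unfolding BS by blast
    let ?D = "\<Sum>x\<in>?W. \<Sum>y\<in>neighbours G x \<inter> ?W. (?f x - ?f y)\<^sup>2"
    have energy_at: "(\<Sum>v\<in>neighbours G w \<inter> ?W. ?f w * (?f w - ?f v)) \<le> (if w = z then d * ?f z else 0)"
      if w: "w \<in> ?W" for w
    proof (cases "?f w = 0")
      case True
      then show ?thesis using u_nonneg[of N z] by (simp add: d_def)
    next
      case False
      have wV: "w \<in> vertices G" using w Bfin by blast
      have "neighbours G w \<inter> ?W = neighbours G w" using supp' wV False by blast
      then have "(\<Sum>v\<in>neighbours G w \<inter> ?W. ?f w * (?f w - ?f v)) =
         ?f w * (real (card (neighbours G w)) * ?f w - (\<Sum>v\<in>neighbours G w. ?f v))"
        by (simp add: sum_distrib_left[symmetric] sum_subtractf)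
      also have "(\<Sum>v\<in>neighbours G w. ?f v) = real (card (neighbours G w)) * (\<Sum>n<N. p (Suc n) w)"
        unfolding u_def by (subst sum.swap) (simp add: pS[OF wV] sum_distrib_left)
      also have "(\<Sum>n<N. p (Suc n) w) = ?f w + p N w - p 0 w"
      proof -
        have "p 0 w + (\<Sum>n<N. p (Suc n) w) = (\<Sum>n<Suc N. p n w)"
          by (rule sum.lessThan_Suc_shift[symmetric])
        then show ?thesis by (simp add: u_def)
      qed
      finally have "(\<Sum>v\<in>neighbours G w \<inter> ?W. ?f w * (?f w - ?f v)) =
         ?f w * real (card (neighbours G w)) * (p 0 w - p N w)"
        by (simp add: algebra_simps)
      also have "\<dots> \<le> ?f w * real (card (neighbours G w)) * p 0 w"
        using u_nonneg p_nonneg by (intro mult_left_mono) simp_all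
      also have "\<dots> \<le> (if w = z then d * ?f z else 0)" by (simp add: p0 d_def)
      finally show ?thesis .
    qed
    have "z \<in> ?W" using Bmono[of 0 "Suc N"] B0 by auto
    moreover have "(\<Sum>w\<in>?W. \<Sum>v\<in>neighbours G w \<inter> ?W. ?f w * (?f w - ?f v)) \<le>
        (\<Sum>w\<in>?W. if w = z then d * ?f z else 0)"
      by (rule sum_mono) (rule energy_at)
    ultimately have "?D \<le> 2 * (d * ?f z)"
      using Bfin[of "Suc N"] by (simp add: dirichlet_form_parts)
    moreover have "(\<Sum>w\<in>?W. (?f w)\<^sup>2) \<le> c * ?D"
      using P supp' Bfin[of "Suc N"] unfolding poincare_def by blast
    moreover have "0 \<le> ?D" by (intro sum_nonneg) simp
    ultimately have sq: "(\<Sum>w\<in>?W. (?f w)\<^sup>2) \<le> 2 * c' * d * ?f z"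
    proof -
      assume a: "?D \<le> 2 * (d * ?f z)" "(\<Sum>w\<in>?W. (?f w)\<^sup>2) \<le> c * ?D" "0 \<le> ?D"
      have "c * ?D \<le> c' * ?D" using a(3) by (intro mult_right_mono) (simp_all add: c'_def)
      also have "\<dots> \<le> c' * (2 * (d * ?f z))" using a(1) by (intro mult_left_mono) (simp_all add: c'_def)
      finally show ?thesis using a(2) by (simp add: mult_ac)
    qed
    have one: "(?f w)\<^sup>2 \<le> 2 * c' * d * ?f z" if "w \<in> vertices G" for w
    proof (cases "?f w = 0")
      case True
      then show ?thesis using u_nonneg[of N z] by (simp add: c'_def d_def)
    next
      case False
      then have "w \<in> ?W" using supp' that by blast
      then have "(?f w)\<^sup>2 \<le> (\<Sum>w\<in>?W. (?f w)\<^sup>2)"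
        using Bfin by (intro member_le_sum) auto
      then show ?thesis using sq by simp
    qed
    have K: "0 \<le> 2 * c' * d" by (simp add: c'_def d_def)
    have uz: "?f z \<le> 2 * c' * d"
    proof (cases "?f z = 0")
      case False
      then have "?f z > 0" using u_nonneg[of N z] by simp
      then show ?thesis using one[OF z] by (simp add: power2_eq_square)
    qed (use K in simp)
    have "(?f y)\<^sup>2 \<le> 2 * c' * d * ?f z" by (rule one[OF y])
    also have "\<dots> \<le> (2 * c' * d)\<^sup>2"
      using mult_left_mono[OF uz K] by (simp only: power2_eq_square)
    finally have "(?f y)\<^sup>2 \<le> (2 * c' * d)\<^sup>2" .
    then show ?thesis using K by (rule power2_le_imp_le)
  qed
  show "summable (\<lambda>n. pmf (walk_law G n x) z)"
  proof (rule summableI_nonneg_bounded)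
    show "0 \<le> pmf (walk_law G n x) z" for n by simp
    show "(\<Sum>n<N. pmf (walk_law G n x) z) \<le> 2 * c' * d" for N
      using bound[OF x, of N] by (simp add: u_def p_def)
  qed
qed

section \<open>Isoperimetry implies a Poincare inequality\<close>

text \<open>The discrete co-area formula. Lowering \<open>g\<close> on its support \<open>T\<close> by its least positive value \<open>m\<close> lowers the left
  side by \<open>m |T|\<close> and the variation by \<open>m\<close> times the number of pairs that leave \<open>T\<close>.\<close>

lemma sum_le_boundary_variation:
  fixes g :: "'a \<Rightarrow> real"
  assumes finQ: "finite Q" and finS: "finite S"
    and iso: "\<And>T. T \<subseteq> S \<Longrightarrow> real (card T) \<le> C * real (card {q \<in> Q. fst q \<in> T \<and> snd q \<notin> T})"
    and g: "\<And>x. g x \<ge> 0" "\<And>x. x \<notin> S \<Longrightarrow> g x = 0"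
  shows "(\<Sum>x\<in>S. g x) \<le> C * (\<Sum>q\<in>Q. max 0 (g (fst q) - g (snd q)))"
  using g
proof (induction "card {x \<in> S. g x \<noteq> 0}" arbitrary: g rule: less_induct)
  case less
  let ?T = "{x \<in> S. g x \<noteq> 0}"
  show ?case
  proof (cases "?T = {}")
    case True
    then have "g x = 0" for x using less.prems by auto
    then show ?thesis by simp
  next
    case False
    have fin: "finite ?T" using finS by simp
    define m where "m = Min (g ` ?T)"
    have mT: "m \<in> g ` ?T" unfolding m_def using fin False by (intro Min_in) auto
    have m: "m \<le> g x" if "x \<in> ?T" for x
      unfolding m_def using fin that by (intro Min_le) auto
    define g' where "g' x = (if x \<in> ?T then g x - m else 0)" for x
    obtain x0 where x0: "x0 \<in> ?T" "g x0 = m" using mT by auto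
    have g'0: "g' x \<ge> 0" for x using m by (simp add: g'_def)
    have g'S: "g' x = 0" if "x \<notin> S" for x using that by (simp add: g'_def)
    have "{x \<in> S. g' x \<noteq> 0} \<subset> ?T"
    proof
      show "{x \<in> S. g' x \<noteq> 0} \<subseteq> ?T" by (auto simp: g'_def)
      show "{x \<in> S. g' x \<noteq> 0} \<noteq> ?T" using x0 by (auto simp: g'_def)
    qed
    then have "card {x \<in> S. g' x \<noteq> 0} < card ?T" using fin by (rule psubset_card_mono[rotated])
    then have IH: "(\<Sum>x\<in>S. g' x) \<le> C * (\<Sum>q\<in>Q. max 0 (g' (fst q) - g' (snd q)))"
      using less.hyps[of g'] g'0 g'S by blast
    have "(\<Sum>x\<in>S. g x) = (\<Sum>x\<in>S. g' x + (if x \<in> ?T then m else 0))"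
      by (intro sum.cong refl) (auto simp: g'_def)
    also have "\<dots> = (\<Sum>x\<in>S. g' x) + m * real (card ?T)"
      using finS by (simp add: sum.distrib flip: sum.inter_filter)
    also have "\<dots> \<le> C * (\<Sum>q\<in>Q. max 0 (g' (fst q) - g' (snd q))) +
        m * (C * real (card {q \<in> Q. fst q \<in> ?T \<and> snd q \<notin> ?T}))"
    proof -
      have "m \<ge> 0" using x0 less.prems(1)[of x0] by simp
      then show ?thesis using IH iso[of ?T] by (intro add_mono mult_left_mono) auto
    qed
    also have "\<dots> = C * (\<Sum>q\<in>Q. max 0 (g' (fst q) - g' (snd q)) +
        (if fst q \<in> ?T \<and> snd q \<notin> ?T then m else 0))"
      using finQ by (simp add: sum.distrib algebra_simps flip: sum.inter_filter)
    also have "(\<Sum>q\<in>Q. max 0 (g' (fst q) - g' (snd q)) +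
        (if fst q \<in> ?T \<and> snd q \<notin> ?T then m else 0)) = (\<Sum>q\<in>Q. max 0 (g (fst q) - g (snd q)))"
    proof (intro sum.cong refl)
      fix q assume "q \<in> Q"
      have out: "g x = 0 \<and> g' x = 0" if "x \<notin> ?T" for x
        using that less.prems(2)[of x] by (auto simp: g'_def)
      have ins: "g x = g' x + m" if "x \<in> ?T" for x
        using that by (simp add: g'_def)
      have m0: "m \<ge> 0" using x0 less.prems(1)[of x0] by simp
      show "max 0 (g' (fst q) - g' (snd q)) + (if fst q \<in> ?T \<and> snd q \<notin> ?T then m else 0) =
          max 0 (g (fst q) - g (snd q))"
      proof (cases "fst q \<in> ?T")
        case True
        show ?thesis
          using ins[OF True] ins[of "snd q"] out[of "snd q"] g'0[of "fst q"] m0 True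
          by (cases "snd q \<in> ?T") simp_all
      next
        case False
        show ?thesis
          using out[OF False] g'0[of "snd q"] less.prems(1)[of "snd q"] False by simp
      qed
    qed
    finally show ?thesis .
  qed
qed

text \<open>Cheeger's argument: the previous bound is applied to \<open>f\<^sup>2\<close>, whose increments factor as
  \<open>(f x - f y) (f x + f y)\<close>.\<close>

lemma sum_square_le_energy:
  fixes f :: "'a \<Rightarrow> real"
  assumes finQ: "finite Q" and finS: "finite S" and C: "C > 0" and k: "k > 0"
    and iso: "\<And>T. T \<subseteq> S \<Longrightarrow> real (card T) \<le> C * real (card {q \<in> Q. fst q \<in> T \<and> snd q \<notin> T})"
    and deg: "\<And>x. card {q \<in> Q. fst q = x} \<le> k" "\<And>x. card {q \<in> Q. snd q = x} \<le> k"
    and f: "\<And>x. x \<notin> S \<Longrightarrow> f x = 0"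
  shows "(\<Sum>x\<in>S. (f x)\<^sup>2) \<le> 4 * k * C\<^sup>2 * (\<Sum>q\<in>Q. (f (fst q) - f (snd q))\<^sup>2)"
proof -
  let ?s = "\<Sum>x\<in>S. (f x)\<^sup>2" and ?D = "\<Sum>q\<in>Q. (f (fst q) - f (snd q))\<^sup>2"
  have by_end: "(\<Sum>q\<in>Q. (f (h q))\<^sup>2) \<le> k * ?s" if h: "\<And>x. card {q \<in> Q. h q = x} \<le> k" for h :: "'a \<times> 'a \<Rightarrow> 'a"
  proof -
    have "(\<Sum>q\<in>Q. (f (h q))\<^sup>2) = (\<Sum>q\<in>Q. \<Sum>x\<in>S. if h q = x then (f x)\<^sup>2 else 0)"
      using finS f by (intro sum.cong refl) (auto simp: sum.delta')
    also have "\<dots> = (\<Sum>x\<in>S. \<Sum>q\<in>Q. if h q = x then (f x)\<^sup>2 else 0)" by (rule sum.swap)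
    also have "\<dots> = (\<Sum>x\<in>S. real (card {q \<in> Q. h q = x}) * (f x)\<^sup>2)"
      using finQ by (simp flip: sum.inter_filter)
    also have "\<dots> \<le> (\<Sum>x\<in>S. k * (f x)\<^sup>2)"
      using h by (intro sum_mono mult_right_mono) auto
    finally show ?thesis by (simp add: sum_distrib_left)
  qed
  \<comment> \<open>weight in the inequality of arithmetic and geometric means, chosen such that half of \<open>\<Sum> f\<^sup>2\<close> can be absorbed\<close>
  define l where "l = 4 * k * C"
  have l: "l > 0" using C k by (simp add: l_def)
  have "max 0 ((f x)\<^sup>2 - (f y)\<^sup>2) \<le> l / 2 * (f x - f y)\<^sup>2 + 1 / l * ((f x)\<^sup>2 + (f y)\<^sup>2)" for x y
  proof -
    let ?a = "f x - f y" and ?b = "f x + f y"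
    have "0 \<le> (l * ?a - ?b)\<^sup>2 / (2 * l)" using l by simp
    also have "\<dots> = l / 2 * ?a\<^sup>2 - ?a * ?b + 1 / (2 * l) * ?b\<^sup>2"
      using l by (simp add: power2_eq_square field_simps)
    finally have "?a * ?b \<le> l / 2 * ?a\<^sup>2 + 1 / (2 * l) * ?b\<^sup>2" by simp
    moreover have "?b\<^sup>2 \<le> 2 * ((f x)\<^sup>2 + (f y)\<^sup>2)"
      using sum_squares_bound[of "f x" "f y"] by (simp add: power2_sum)
    then have "1 / (2 * l) * ?b\<^sup>2 \<le> 1 / (2 * l) * (2 * ((f x)\<^sup>2 + (f y)\<^sup>2))"
      using l by (intro mult_left_mono) simp_all
    moreover have "1 / (2 * l) * (2 * ((f x)\<^sup>2 + (f y)\<^sup>2)) = 1 / l * ((f x)\<^sup>2 + (f y)\<^sup>2)"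
      using l by (simp add: field_simps)
    moreover have "?a * ?b = (f x)\<^sup>2 - (f y)\<^sup>2" by (simp add: power2_eq_square algebra_simps)
    moreover have "0 \<le> l / 2 * (f x - f y)\<^sup>2 + 1 / l * ((f x)\<^sup>2 + (f y)\<^sup>2)"
      using l by (intro add_nonneg_nonneg mult_nonneg_nonneg) simp_all
    ultimately show ?thesis by linarith
  qed
  then have pw: "(\<Sum>q\<in>Q. max 0 ((f (fst q))\<^sup>2 - (f (snd q))\<^sup>2)) \<le>
      (\<Sum>q\<in>Q. l / 2 * (f (fst q) - f (snd q))\<^sup>2 + 1 / l * ((f (fst q))\<^sup>2 + (f (snd q))\<^sup>2))"
    by (intro sum_mono)
  also have "\<dots> = l / 2 * ?D + 1 / l * ((\<Sum>q\<in>Q. (f (fst q))\<^sup>2) + (\<Sum>q\<in>Q. (f (snd q))\<^sup>2))"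
    by (simp add: sum.distrib sum_distrib_left add_divide_distrib sum_divide_distrib)
  also have "\<dots> \<le> l / 2 * ?D + 1 / l * (k * ?s + k * ?s)"
    using by_end[OF deg(1)] by_end[OF deg(2)] l by (intro add_left_mono mult_left_mono add_mono) simp_all
  finally have E: "(\<Sum>q\<in>Q. max 0 ((f (fst q))\<^sup>2 - (f (snd q))\<^sup>2)) \<le> l / 2 * ?D + 1 / l * (k * ?s + k * ?s)" .
  have "?s \<le> C * (\<Sum>q\<in>Q. max 0 ((f (fst q))\<^sup>2 - (f (snd q))\<^sup>2))"
    by (rule sum_le_boundary_variation[OF finQ finS iso]) (use f in auto)
  also have "\<dots> \<le> C * (l / 2 * ?D + 1 / l * (k * ?s + k * ?s))"
    using E C by (intro mult_left_mono) simp_all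
  also have "\<dots> = 2 * k * C\<^sup>2 * ?D + ?s / 2"
    using C k by (simp add: l_def field_simps power2_eq_square)
  finally show ?thesis by simp
qed

section \<open>Opening the roundabouts into paths\<close>

text \<open>Along the arc, the distance from \<open>v\<close> is continuous, starts at 0 and ends at that of the other endvertex.
  So every smaller radius is attained, and the set of times where this happens is closed.\<close>

lemma first_hit_on_arc:
  assumes G: "is_plane_graph G" and e: "e \<in> edges G" "v \<in> e"
  shows "\<forall>\<^sub>F r in at_right 0. dist (pos G v) (first_hit G v r e) = r \<and>
    first_hit G v r e \<in> path_image (arc_of G e)"
proof -
  define h where "h = arc_from G v e"
  have "\<forall>e\<in>edges G. arc (arc_of G e) \<and> {pathstart (arc_of G e), pathfinish (arc_of G e)} = pos G ` e"
    using G unfolding is_plane_graph_def by (elim conjE)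
  then have a: "arc (arc_of G e)" "{pathstart (arc_of G e), pathfinish (arc_of G e)} = pos G ` e"
    using e by auto
  have "pos G v \<in> {pathstart (arc_of G e), pathfinish (arc_of G e)}"
    unfolding a(2) using e(2) by simp
  then have start: "pathstart h = pos G v"
    by (auto simp: h_def arc_from_def)
  have arc: "arc h" using a(1) by (simp add: h_def arc_from_def arc_reversepath)
  have img: "path_image h = path_image (arc_of G e)" by (simp add: h_def arc_from_def)
  define d where "d = dist (pos G v) (pathfinish h)"
  have "d > 0"
    using arc_distinct_ends[OF arc] start by (simp add: d_def)
  have hit: "dist (pos G v) (first_hit G v r e) = r \<and> first_hit G v r e \<in> path_image (arc_of G e)"
    if r: "r \<in> {0<..<d}" for r
  proof -
    define S where "S = {t \<in> {0..1}. dist (pos G v) (h t) = r}"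
    have cont: "continuous_on {0..1} (\<lambda>t. dist (pos G v) (h t))"
      using arc_imp_path[OF arc] unfolding path_def by (intro continuous_intros)
    have "\<exists>t. 0 \<le> t \<and> t \<le> 1 \<and> dist (pos G v) (h t) = r"
      using r start by (intro IVT' cont) (auto simp: d_def pathstart_def pathfinish_def)
    then have "S \<noteq> {}" by (auto simp: S_def)
    moreover have "closed S"
    proof -
      have "S = {0..1} \<inter> (\<lambda>t. dist (pos G v) (h t)) -` {r}" by (auto simp: S_def)
      then show ?thesis using continuous_closed_preimage[OF cont] by simp
    qed
    moreover have "bdd_below S" by (auto simp: S_def intro: bdd_belowI[of _ 0])
    ultimately have "Inf S \<in> S" by (intro closed_contains_Inf)
    moreover have "first_hit G v r e = h (Inf S)" by (simp add: first_hit_def h_def S_def)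
    ultimately show ?thesis unfolding img[symmetric] by (auto simp: S_def path_image_def)
  qed
  show ?thesis
    using eventually_at_right_real[OF \<open>d > 0\<close>] by (rule eventually_mono) (rule hit)
qed

text \<open>Fix one radius that is small enough for all of the finitely many triples in the relation \<open>ccw_order\<close>, and number the edges by
  the angles of their first hitting points. An edge strictly between two edges with successive numbers would need
  an angle between theirs.\<close>

lemma ex_consecutive_numbering:
  assumes G: "is_plane_graph G" and fin: "finite (incident_edges G v)"
  shows "\<exists>num :: 'v set \<Rightarrow> nat. inj_on num (incident_edges G v) \<and>
    num ` incident_edges G v = {..<card (incident_edges G v)} \<and>
    (\<forall>e\<in>incident_edges G v. \<forall>f\<in>incident_edges G v. num f = Suc (num e) \<longrightarrow> consecutive G v e f)"
proof -
  let ?I = "incident_edges G v"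
  have sg: "simple_graph G" and crosses: "\<forall>e\<in>edges G. \<forall>f\<in>edges G. e \<noteq> f \<longrightarrow>
        path_image (arc_of G e) \<inter> path_image (arc_of G f) = pos G ` (e \<inter> f)"
    using G unfolding is_plane_graph_def by - (elim conjE, assumption)+
  have I: "e \<in> edges G" "v \<in> e" if "e \<in> ?I" for e using that by (auto simp: incident_edges_def)
  have ev1: "\<forall>\<^sub>F r in at_right 0. \<forall>e\<in>?I. dist (pos G v) (first_hit G v r e) = r \<and>
    first_hit G v r e \<in> path_image (arc_of G e)"
    using first_hit_on_arc[OF G] I fin by (intro eventually_ball_finite) auto
  let ?ang = "\<lambda>r e f. ccw_angle (pos G v) (first_hit G v r e) (first_hit G v r f)"
  have ev2: "\<forall>\<^sub>F r in at_right 0. \<forall>t\<in>{(e, f, g). ccw_order G v e f g}.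
      ?ang r (fst t) (fst (snd t)) < ?ang r (fst t) (snd (snd t))"
  proof (intro eventually_ball_finite ballI)
    have "{(e, f, g). ccw_order G v e f g} \<subseteq> ?I \<times> ?I \<times> ?I" by (auto simp: ccw_order_def)
    then show "finite {(e, f, g). ccw_order G v e f g}"
      using fin by (meson finite_SigmaI finite_subset)
  qed (auto simp: ccw_order_def)
  have "\<forall>\<^sub>F r in at_right (0::real). 0 < r" by (rule eventually_at_right_less)
  with ev1 ev2 have "\<forall>\<^sub>F r in at_right 0. 0 < r \<and> (\<forall>e\<in>?I. dist (pos G v) (first_hit G v r e) = r \<and>
      first_hit G v r e \<in> path_image (arc_of G e)) \<and> (\<forall>t\<in>{(e, f, g). ccw_order G v e f g}.
      ?ang r (fst t) (fst (snd t)) < ?ang r (fst t) (snd (snd t)))"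
    by eventually_elim simp
  from eventually_happens'[OF trivial_limit_at_right_real this]
  obtain r where r: "0 < r" and hit': "\<forall>e\<in>?I. dist (pos G v) (first_hit G v r e) = r \<and>
      first_hit G v r e \<in> path_image (arc_of G e)"
    and ord': "\<forall>t\<in>{(e, f, g). ccw_order G v e f g}. ?ang r (fst t) (fst (snd t)) < ?ang r (fst t) (snd (snd t))"
    by (elim exE conjE)
  have hit: "dist (pos G v) (first_hit G v r e) = r" "first_hit G v r e \<in> path_image (arc_of G e)"
    if "e \<in> ?I" for e using hit' that by simp_all
  have ord: "?ang r e f < ?ang r e g" if "ccw_order G v e f g" for e f g
    using bspec[OF ord', of "(e, f, g)"] that by simp
  define w where "w e = first_hit G v r e - pos G v" for e
  define \<theta> where "\<theta> e = Arg2pi (w e)" for e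
  have normw: "cmod (w e) = r" if "e \<in> ?I" for e
    using hit(1)[OF that] by (simp add: w_def dist_norm norm_minus_commute)
  have w0: "w e \<noteq> 0" if "e \<in> ?I" for e using normw[OF that] r by auto
  have inj\<theta>: "inj_on \<theta> ?I"
  proof (rule inj_onI, rule ccontr)
    fix e f assume ef: "e \<in> ?I" "f \<in> ?I" "\<theta> e = \<theta> f" "e \<noteq> f"
    obtain x where x: "x > 0" "w e = complex_of_real x * w f"
      using ef(3) Arg2pi_eq_iff[OF w0[OF ef(1)] w0[OF ef(2)]] unfolding \<theta>_def by blast
    have "x = 1" using arg_cong[OF x(2), of cmod] normw[OF ef(1)] normw[OF ef(2)] r x(1)
      by (simp add: norm_mult)
    then have "first_hit G v r e = first_hit G v r f" using x(2) by (simp add: w_def)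
    then have "first_hit G v r e \<in> path_image (arc_of G e) \<inter> path_image (arc_of G f)"
      using hit(2)[OF ef(1)] hit(2)[OF ef(2)] by simp
    then have mem: "first_hit G v r e \<in> pos G ` (e \<inter> f)"
      using crosses I(1)[OF ef(1)] I(1)[OF ef(2)] ef(4) by blast
    have card: "card e = 2" "card f = 2"
      using sg I(1)[OF ef(1)] I(1)[OF ef(2)] by (auto simp: simple_graph_def)
    have "e \<inter> f = {v}"
    proof -
      obtain a b where "e = {v, a}" "f = {v, b}" "a \<noteq> v" "b \<noteq> v"
        using card I(2)[OF ef(1)] I(2)[OF ef(2)] by (auto simp: card_2_iff)
      then show ?thesis using ef(4) by auto
    qed
    then have "w e = 0" using mem by (simp add: w_def)
    then show False using w0[OF ef(1)] by simp
  qed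
  \<comment> \<open>turning from \<open>e\<close> to \<open>f\<close> passes the direction of angle 0 at most once\<close>
  have ang: "\<theta> e + ?ang r e f = \<theta> f \<or> \<theta> e + ?ang r e f = 2 * pi + \<theta> f" if "e \<in> ?I" "f \<in> ?I" for e f
    using Arg2pi_add[OF w0[OF that(1)], of "w f / w e"] w0[OF that(1)] w0[OF that(2)]
    by (auto simp: ccw_angle_def \<theta>_def w_def split: if_splits)
  have \<theta>2: "0 \<le> \<theta> e" "\<theta> e < 2 * pi" for e using Arg2pi[of "w e"] by (auto simp: \<theta>_def)
  have ang2: "0 \<le> ?ang r e f" "?ang r e f < 2 * pi" for e f
    using Arg2pi by (auto simp: ccw_angle_def)
  define num where "num e = card {g \<in> ?I. \<theta> g < \<theta> e}" for e
  have num_less: "num e < num f" if "e \<in> ?I" "\<theta> e < \<theta> f" for e f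
  proof -
    have "{g \<in> ?I. \<theta> g < \<theta> e} \<subset> {g \<in> ?I. \<theta> g < \<theta> f}" using that by auto
    then show ?thesis unfolding num_def using fin by (intro psubset_card_mono) auto
  qed
  have injn: "inj_on num ?I"
  proof (rule inj_onI, rule ccontr)
    fix e f assume ef: "e \<in> ?I" "f \<in> ?I" "num e = num f" "e \<noteq> f"
    then have "\<theta> e \<noteq> \<theta> f" using inj\<theta> by (auto dest: inj_onD)
    then consider "\<theta> e < \<theta> f" | "\<theta> f < \<theta> e" by linarith
    then show False using num_less[OF ef(1)] num_less[OF ef(2)] ef(3) by cases fastforce+
  qed
  have "num ` ?I \<subseteq> {..<card ?I}"
  proof
    fix n assume "n \<in> num ` ?I"
    then obtain e where e: "e \<in> ?I" "n = num e" by auto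
    have "{g \<in> ?I. \<theta> g < \<theta> e} \<subset> ?I" using e by auto
    then show "n \<in> {..<card ?I}" unfolding e(2) num_def using psubset_card_mono[OF fin] by simp
  qed
  then have img: "num ` ?I = {..<card ?I}"
    using card_image[OF injn] by (intro card_subset_eq) auto
  have "consecutive G v e f" if ef: "e \<in> ?I" "f \<in> ?I" "num f = Suc (num e)" for e f
  proof -
    have lt: "\<theta> e < \<theta> f"
    proof (rule ccontr)
      assume "\<not> \<theta> e < \<theta> f"
      then consider "\<theta> f < \<theta> e" | "\<theta> e = \<theta> f" by linarith
      then show False
        using num_less[of f e] ef inj_onD[OF inj\<theta>, of e f] by cases auto
    qed
    have "\<not> ccw_order G v e g f" for g
    proof
      assume o: "ccw_order G v e g f"
      then have g: "g \<in> ?I" "g \<noteq> e" "g \<noteq> f" by (auto simp: ccw_order_def)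
      have "?ang r e g < ?ang r e f" by (rule ord[OF o])
      then have "\<theta> e \<le> \<theta> g \<and> \<theta> g < \<theta> f"
        using ang[OF ef(1,2)] ang[OF ef(1) g(1)] lt \<theta>2[of e] \<theta>2[of f] \<theta>2[of g] ang2[of e g] ang2[of e f]
        by linarith
      moreover have "\<theta> e \<noteq> \<theta> g" using inj_onD[OF inj\<theta>, of e g] ef(1) g(1,2) by metis
      ultimately have "num e < num g" "num g < num f"
        using num_less[OF ef(1), of g] num_less[OF g(1), of f] by simp_all
      then show False using ef(3) by simp
    qed
    then show ?thesis unfolding consecutive_def using ef by auto
  qed
  then show ?thesis using injn img by blast
qed

text \<open>With a numbering as above, the subgraph of the roundabout graph in which each cycle has lost the edge between its last and its
  first vertex, as a symmetric relation.\<close>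

definition opened_roundabout ::
  "('v, 'z) plane_graph_scheme \<Rightarrow> ('v \<Rightarrow> 'v set \<Rightarrow> nat) \<Rightarrow> (('v \<times> 'v set) \<times> ('v \<times> 'v set)) set" where
  "opened_roundabout G num = {((v, e), (w, f)). e \<in> edges G \<and> f \<in> edges G \<and> v \<in> e \<and> w \<in> f \<and>
     (e = f \<and> v \<noteq> w \<or> v = w \<and> (num v f = Suc (num v e) \<or> num v e = Suc (num v f)))}"

lemma sym_opened_roundabout: "sym (opened_roundabout G num)"
  by (auto simp: sym_def opened_roundabout_def)

lemma degree_opened_roundabout:
  assumes G: "simple_graph G" and num: "\<And>v. inj_on (num v) (incident_edges G v)"
  shows "finite (opened_roundabout G num `` {x}) \<and> card (opened_roundabout G num `` {x}) \<le> 3"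
proof (cases "snd x \<in> edges G \<and> fst x \<in> snd x")
  case False
  then have "opened_roundabout G num `` {x} = {}" by (auto simp: opened_roundabout_def)
  then show ?thesis by simp
next
  case True
  define v e where "v = fst x" and "e = snd x"
  have e: "e \<in> edges G" "v \<in> e" "card e = 2" and x: "x = (v, e)"
    using True G by (auto simp: v_def e_def simple_graph_def)
  have fin: "finite e" using e(3) card.infinite by fastforce
  let ?inv = "inv_into (incident_edges G v) (num v)"
  let ?S = "{(v, ?inv (Suc (num v e))), (v, ?inv (num v e - 1))}"
  have sub: "opened_roundabout G num `` {x} \<subseteq> (\<lambda>w. (w, e)) ` (e - {v}) \<union> ?S"
  proof
    fix y assume "y \<in> opened_roundabout G num `` {x}"
    then obtain w f where y: "y = (w, f)" and f: "f \<in> edges G" "w \<in> f"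
      and c: "e = f \<and> v \<noteq> w \<or> v = w \<and> (num v f = Suc (num v e) \<or> num v e = Suc (num v f))"
      unfolding x by (auto simp: opened_roundabout_def)
    show "y \<in> (\<lambda>w. (w, e)) ` (e - {v}) \<union> ?S"
    proof (cases "v = w")
      case True
      have "f \<in> incident_edges G v" using f True by (simp add: incident_edges_def)
      then have "?inv (num v f) = f" using num by simp
      moreover have "num v f = Suc (num v e) \<or> num v f = num v e - 1"
        using c True by auto
      ultimately show ?thesis using y True by auto
    next
      case False
      then show ?thesis using c y f by auto
    qed
  qed
  have "card ((\<lambda>w. (w, e)) ` (e - {v}) \<union> ?S) \<le> card ((\<lambda>w. (w, e)) ` (e - {v})) + card ?S"
    by (rule card_Un_le)
  also have "\<dots> \<le> 1 + 2"
    using card_image_le[of "e - {v}" "\<lambda>w. (w, e)"] fin e by (intro add_mono) (simp_all add: card_insert_if)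
  finally have c3: "card ((\<lambda>w. (w, e)) ` (e - {v}) \<union> ?S) \<le> 3" by simp
  have fin': "finite ((\<lambda>w. (w, e)) ` (e - {v}) \<union> ?S)" using fin by simp
  show ?thesis using finite_subset[OF sub fin'] card_mono[OF fin' sub] c3 by simp
qed

section \<open>Isoperimetry of the opened roundabout graph\<close>

lemma initial_segment_switch:
  fixes d :: nat
  assumes "a < d" "b < d" "P a" "\<not> P b"
  shows "\<exists>i. Suc i < d \<and> P i \<noteq> P (Suc i)"
proof (rule ccontr)
  assume n: "\<not> ?thesis"
  have "i < d \<Longrightarrow> P i = P 0" for i
    by (induction i) (use n in auto)
  then show False using assms by blast
qed

text \<open>With full and split vertices as in the introduction, \<open>A\<close> and \<open>B\<close>, and the boundary \<open>D\<close>, the proof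
  combines \<open>|B| \<le> |D|\<close>, \<open>\<gamma> |A| \<le> |B| + |D|\<close> and \<open>|T| \<le> |D| + 6 (|A| + |B|)\<close>.\<close>

lemma isoperimetry_opened_roundabout:
  fixes G :: "('v, 'z) plane_graph_scheme"
  assumes G: "simple_graph G" and num: "\<And>v. inj_on (num v) (incident_edges G v)"
    and img: "\<And>v. v \<in> vertices G \<Longrightarrow> num v ` incident_edges G v = {..<card (incident_edges G v)}"
    and sparse: "\<And>S. finite S \<Longrightarrow> S \<subseteq> vertices G \<Longrightarrow> card {e \<in> edges G. e \<subseteq> S} \<le> 3 * card S"
    and \<gamma>: "\<gamma> > 0" and expand: "\<And>S. finite S \<Longrightarrow> S \<subseteq> vertices G \<Longrightarrow>
      real (card (vertex_boundary G S)) \<ge> \<gamma> * real (card S)"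
    and T: "finite T" "T \<subseteq> {(v, e). e \<in> edges G \<and> v \<in> e}"
  shows "real (card T) \<le> (7 + 12 / \<gamma>) *
    real (card {q \<in> opened_roundabout G num. fst q \<in> T \<and> snd q \<notin> T})"
proof -
  let ?H = "opened_roundabout G num"
  define D where "D = {q \<in> ?H. fst q \<in> T \<and> snd q \<notin> T}"
  have finD: "finite D"
  proof (rule finite_subset)
    show "D \<subseteq> Sigma T (\<lambda>x. ?H `` {x})" by (auto simp: D_def)
    show "finite (Sigma T (\<lambda>x. ?H `` {x}))"
      using T(1) degree_opened_roundabout[where num=num, OF G num] by auto
  qed
  define full where "full v \<longleftrightarrow> (\<forall>e\<in>incident_edges G v. (v, e) \<in> T)" for v
  define A where "A = {v \<in> fst ` T. full v}"
  define B where "B = {v \<in> fst ` T. \<not> full v}"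
  have finAB: "finite A" "finite B" using T(1) by (auto simp: A_def B_def)
  have AB: "A \<union> B = fst ` T" by (auto simp: A_def B_def)
  have edge: "e \<subseteq> vertices G" "card e = 2" if "e \<in> edges G" for e
    using that G by (auto simp: simple_graph_def)
  have Tv: "e \<in> edges G \<and> v \<in> e \<and> v \<in> vertices G" if "(v, e) \<in> T" for v e
    using that T(2) edge by blast
  have sub: "A \<subseteq> vertices G" "B \<subseteq> vertices G" using Tv by (auto simp: A_def B_def)
  have B_le: "card B \<le> card D"
  proof -
    have "B \<subseteq> (fst \<circ> fst) ` D"
    proof
      fix v assume v: "v \<in> B"
      then obtain e e' where e: "(v, e) \<in> T" "e' \<in> incident_edges G v" "(v, e') \<notin> T"
        by (auto simp: B_def full_def)
      let ?I = "incident_edges G v"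
      have eI: "e \<in> ?I" using Tv[OF e(1)] by (simp add: incident_edges_def)
      define P where "P i \<longleftrightarrow> (v, inv_into ?I (num v) i) \<in> T" for i
      have inv: "inv_into ?I (num v) (num v f) = f" if "f \<in> ?I" for f
        using that num by simp
      have vV: "v \<in> vertices G" using v sub by auto
      have "num v e < card ?I" "num v e' < card ?I" using img[OF vV] eI e(2) by blast+
      moreover have "P (num v e)" "\<not> P (num v e')" using e inv eI by (auto simp: P_def)
      ultimately obtain i where i: "Suc i < card ?I" "P i \<noteq> P (Suc i)"
        using initial_segment_switch[of "num v e" "card ?I" "num v e'" P] by blast
      then have "i \<in> num v ` ?I" "Suc i \<in> num v ` ?I" unfolding img[OF vV] by auto
      then obtain f g where fg: "f \<in> ?I" "i = num v f" "g \<in> ?I" "Suc i = num v g" by blast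
      have "P i \<longleftrightarrow> (v, f) \<in> T"
        using inv[OF fg(1)] by (simp add: P_def fg(2))
      moreover have "P (Suc i) \<longleftrightarrow> (v, g) \<in> T"
        unfolding P_def fg(4) inv[OF fg(3)] ..
      moreover have "((v, f), (v, g)) \<in> ?H" "((v, g), (v, f)) \<in> ?H"
        using fg by (auto simp: opened_roundabout_def incident_edges_def)
      ultimately have "((v, f), (v, g)) \<in> D \<or> ((v, g), (v, f)) \<in> D"
        using i(2) by (auto simp: D_def)
      then show "v \<in> (fst \<circ> fst) ` D" by force
    qed
    then show ?thesis by (rule surj_card_le[OF finD])
  qed
  have bd_le: "card (vertex_boundary G A) \<le> card B + card D"
  proof -
    have "vertex_boundary G A \<subseteq> B \<union> (fst \<circ> snd) ` D"
    proof
      fix w assume "w \<in> vertex_boundary G A"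
      then obtain v where w: "w \<notin> A" "v \<in> A" "{v, w} \<in> edges G" by (auto simp: vertex_boundary_def)
      let ?e = "{v, w}"
      have vT: "(v, ?e) \<in> T" using w by (auto simp: A_def full_def incident_edges_def)
      show "w \<in> B \<union> (fst \<circ> snd) ` D"
      proof (cases "(w, ?e) \<in> T")
        case True
        then have "w \<in> A \<union> B" unfolding AB by force
        then show ?thesis using w(1) by simp
      next
        case False
        have "v \<noteq> w" using w by auto
        then have "((v, ?e), (w, ?e)) \<in> D"
          using vT False w(3) by (auto simp: D_def opened_roundabout_def)
        then show ?thesis by force
      qed
    qed
    then have "card (vertex_boundary G A) \<le> card (B \<union> (fst \<circ> snd) ` D)"
      using finAB finD by (intro card_mono) auto
    also have "\<dots> \<le> card B + card ((fst \<circ> snd) ` D)" by (rule card_Un_le)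
    also have "\<dots> \<le> card B + card D" using card_image_le[OF finD] by simp
    finally show ?thesis .
  qed
  have T_le: "card T \<le> card D + 6 * (card A + card B)"
  proof -
    let ?E = "{e \<in> edges G. e \<subseteq> A \<union> B}"
    have T_sub: "T \<subseteq> fst ` D \<union> (\<lambda>(e, v). (v, e)) ` Sigma ?E (\<lambda>e. e)"
    proof
      fix x assume "x \<in> T"
      then obtain v e where x: "x = (v, e)" "(v, e) \<in> T" by (cases x) auto
      have e: "e \<in> edges G" "v \<in> e" using Tv[OF x(2)] by auto
      obtain w where w: "e = {v, w}" "v \<noteq> w" using edge(2)[OF e(1)] e(2) by (auto simp: card_2_iff)
      have H: "((v, e), (w, e)) \<in> ?H" using e w by (auto simp: opened_roundabout_def)
      show "x \<in> fst ` D \<union> (\<lambda>(e, v). (v, e)) ` Sigma ?E (\<lambda>e. e)"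
      proof (cases "(w, e) \<in> T")
        case True
        then have "e \<subseteq> A \<union> B" unfolding AB w(1) using x(2) w(1) by force
        then show ?thesis using e x(1) by force
      next
        case False
        then have "((v, e), (w, e)) \<in> D" using H x by (simp add: D_def)
        then show ?thesis using x(1) by force
      qed
    qed
    have finE: "finite ?E"
      by (rule finite_subset[of _ "Pow (A \<union> B)"]) (use finAB in auto)
    have fin_e: "finite e" if "e \<in> ?E" for e
      using that edge(2)[of e] card.infinite by fastforce
    then have finSig: "finite (Sigma ?E (\<lambda>e. e))"
      using finE fin_e by (intro finite_SigmaI)
    have "card T \<le> card (fst ` D \<union> (\<lambda>(e, v). (v, e)) ` Sigma ?E (\<lambda>e. e))"
      using finD finSig T_sub by (intro card_mono finite_UnI finite_imageI)
    also have "\<dots> \<le> card (fst ` D) + card ((\<lambda>(e, v). (v, e)) ` Sigma ?E (\<lambda>e. e))" by (rule card_Un_le)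
    also have "\<dots> \<le> card D + card (Sigma ?E (\<lambda>e. e))"
      using card_image_le[OF finD] card_image_le[OF finSig] by (rule add_mono)
    also have "card (Sigma ?E (\<lambda>e. e)) = (\<Sum>e\<in>?E. card e)"
      using finE fin_e by (intro card_SigmaI) simp_all
    also have "\<dots> = 2 * card ?E" using edge(2) by simp
    also have "card ?E \<le> 3 * card (A \<union> B)" using sparse[of "A \<union> B"] finAB sub by simp
    also have "card (A \<union> B) \<le> card A + card B" by (rule card_Un_le)
    finally show ?thesis by simp
  qed
  have "\<gamma> * real (card A) \<le> real (card B + card D)"
    using expand[OF finAB(1) sub(1)] bd_le by linarith
  also have "\<dots> \<le> 2 * real (card D)" using B_le by simp
  finally have "real (card A) \<le> 2 / \<gamma> * real (card D)"
    using \<gamma> by (simp add: field_simps)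
  moreover have "real (card T) \<le> real (card D) + 6 * (real (card A) + real (card B))"
    using of_nat_mono[OF T_le, where 'a = real] by simp
  moreover have "real (card B) \<le> real (card D)" using B_le by simp
  ultimately have "real (card T) \<le> real (card D) + 6 * (2 / \<gamma> * real (card D) + real (card D))"
    by (meson add_left_mono add_mono mult_left_mono order_trans zero_le_numeral)
  also have "\<dots> = (7 + 12 / \<gamma>) * real (card D)" by (simp add: algebra_simps)
  finally show ?thesis by (simp add: D_def)
qed

section \<open>Transience of the roundabout graph\<close>

lemma neighbours_roundabout:
  assumes G: "simple_graph G" and fin: "locally_finite G" and x: "x \<in> vertices (roundabout G)"
  shows "finite (neighbours (roundabout G) x)" "neighbours (roundabout G) x \<noteq> {}"
    "neighbours (roundabout G) x \<subseteq> vertices (roundabout G)"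
proof -
  obtain v e where ve: "x = (v, e)" "e \<in> edges G" "v \<in> e" using x by (auto simp: roundabout_def)
  have e: "e \<subseteq> vertices G" "card e = 2" using G ve by (auto simp: simple_graph_def)
  obtain w where w: "e = {v, w}" "v \<noteq> w" using e(2) ve(3) by (auto simp: card_2_iff)
  have sub: "neighbours (roundabout G) x \<subseteq> (\<lambda>w. (w, e)) ` e \<union> Pair v ` incident_edges G v"
  proof
    fix y assume "y \<in> neighbours (roundabout G) x"
    then have "{x, y} \<in> edges (roundabout G)" by (simp add: neighbours_def)
    then consider a b f where "{x, y} = {(a, f), (b, f)}" "f = {a, b}"
      | a f g where "{x, y} = {(a, f), (a, g)}" "consecutive G a f g"
      unfolding roundabout_def by auto
    then show "y \<in> (\<lambda>w. (w, e)) ` e \<union> Pair v ` incident_edges G v"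
    proof cases
      case 1
      then show ?thesis using ve(1) by (auto simp: doubleton_eq_iff)
    next
      case 2
      then have "f \<in> incident_edges G a" "g \<in> incident_edges G a" by (auto simp: consecutive_def)
      then show ?thesis using 2(1) ve(1) by (auto simp: doubleton_eq_iff)
    qed
  qed
  have "finite (incident_edges G v)" using fin e(1) ve(3) by (auto simp: locally_finite_def)
  moreover have "finite e" using w by simp
  ultimately show "finite (neighbours (roundabout G) x)" using sub finite_subset by blast
  show "neighbours (roundabout G) x \<subseteq> vertices (roundabout G)"
    using sub ve(2) by (force simp: roundabout_def incident_edges_def)
  have "{x, (w, e)} \<in> edges (roundabout G)"
    using ve w(1) unfolding roundabout_def by auto
  then show "neighbours (roundabout G) x \<noteq> {}" by (auto simp: neighbours_def)
qed

theorem theorem1p4: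
  fixes G :: "'v plane_graph"
  assumes "is_plane_graph G"
    and "connected_graph G"
    and "locally_finite G"
    and "nonamenable G"
  shows "roundabout_transient G"
proof -
  have sg: "simple_graph G" using assms(1) unfolding is_plane_graph_def by (elim conjE)
  obtain \<gamma> where \<gamma>: "\<gamma> > 0" "\<And>S. finite S \<Longrightarrow> S \<subseteq> vertices G \<Longrightarrow>
      real (card (vertex_boundary G S)) \<ge> \<gamma> * real (card S)"
    using assms(4) unfolding nonamenable_def by blast
  have fin: "finite (incident_edges G v)" for v
  proof (cases "v \<in> vertices G")
    case True
    then show ?thesis using assms(3) by (simp add: locally_finite_def)
  next
    case False
    then have "incident_edges G v = {}" using sg by (auto simp: incident_edges_def simple_graph_def)
    then show ?thesis by simp
  qed
  have "\<forall>v. \<exists>n :: 'v set \<Rightarrow> nat. inj_on n (incident_edges G v) \<and>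
    n ` incident_edges G v = {..<card (incident_edges G v)} \<and>
    (\<forall>e\<in>incident_edges G v. \<forall>f\<in>incident_edges G v. n f = Suc (n e) \<longrightarrow> consecutive G v e f)"
    using ex_consecutive_numbering[OF assms(1) fin] by blast
  then obtain num :: "'v \<Rightarrow> 'v set \<Rightarrow> nat" where num: "\<And>v. inj_on (num v) (incident_edges G v)"
    "\<And>v. num v ` incident_edges G v = {..<card (incident_edges G v)}"
    "\<And>v e f. e \<in> incident_edges G v \<Longrightarrow> f \<in> incident_edges G v \<Longrightarrow> num v f = Suc (num v e) \<Longrightarrow> consecutive G v e f"
    by metis
  let ?R = "roundabout G" and ?H = "opened_roundabout G num"
  have HR: "y \<in> neighbours ?R x" if "(x, y) \<in> ?H" for x y
  proof -
    obtain v e w f where xy: "x = (v, e)" "y = (w, f)" by (cases x, cases y)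
    have c: "e \<in> edges G" "f \<in> edges G" "v \<in> e" "w \<in> f"
      "e = f \<and> v \<noteq> w \<or> v = w \<and> (num v f = Suc (num v e) \<or> num v e = Suc (num v f))"
      using that by (auto simp: xy opened_roundabout_def)
    have card: "card e = 2" "e \<subseteq> vertices G" using sg c(1) by (auto simp: simple_graph_def)
    from c(5) have "{x, y} \<in> edges ?R"
    proof
      assume a: "e = f \<and> v \<noteq> w"
      then have "e = {v, w}" using card c(3,4) by (auto simp: card_2_iff)
      then show ?thesis using a c(1) xy unfolding roundabout_def by auto
    next
      assume a: "v = w \<and> (num v f = Suc (num v e) \<or> num v e = Suc (num v f))"
      then have "consecutive G v e f \<or> consecutive G v f e"
        using num(3) c by (auto simp: incident_edges_def)
      then have "consecutive G v e f" by (auto simp: consecutive_def)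
      then show ?thesis using a c(3) card(2) xy unfolding roundabout_def by auto
    qed
    then show ?thesis by (simp add: neighbours_def)
  qed
  define C where "C = 7 + 12 / \<gamma>"
  have C: "C > 0" using \<gamma>(1) by (simp add: C_def add_pos_pos)
  have "poincare ?R (4 * 3 * C\<^sup>2)"
    unfolding poincare_def
  proof (intro allI impI, elim conjE)
    fix f :: "'v \<times> 'v set \<Rightarrow> real" and W
    assume W: "finite W" "W \<subseteq> vertices ?R"
      and supp: "\<forall>x\<in>vertices ?R. f x \<noteq> 0 \<longrightarrow> x \<in> W \<and> neighbours ?R x \<subseteq> W"
    define S where "S = {x \<in> W. f x \<noteq> 0}"
    \<comment> \<open>\<open>f\<close> is arbitrary outside the vertex set of the roundabout graph\<close>
    define g where "g x = (if x \<in> W then f x else 0)" for x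
    define Q where "Q = ?H \<inter> W \<times> W"
    have finQ: "finite Q" and finS: "finite S" using W by (auto simp: Q_def S_def)
    have iso: "real (card T) \<le> C * real (card {q \<in> Q. fst q \<in> T \<and> snd q \<notin> T})" if T: "T \<subseteq> S" for T
    proof -
      have "{q \<in> ?H. fst q \<in> T \<and> snd q \<notin> T} = {q \<in> Q. fst q \<in> T \<and> snd q \<notin> T}"
      proof -
        have "q \<in> W \<times> W" if q: "q \<in> ?H" "fst q \<in> T" for q
        proof -
          have "fst q \<in> W" "f (fst q) \<noteq> 0" using q T by (auto simp: S_def)
          moreover have "snd q \<in> neighbours ?R (fst q)" using HR q(1) by simp
          ultimately have "snd q \<in> W" using supp W(2) by blast
          then show ?thesis using \<open>fst q \<in> W\<close> by (simp add: mem_Times_iff)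
        qed
        then show ?thesis by (auto simp: Q_def)
      qed
      moreover have "finite T" using T finS finite_subset by blast
      moreover have "T \<subseteq> {(v, e). e \<in> edges G \<and> v \<in> e}"
        using T W(2) by (auto simp: S_def roundabout_def)
      ultimately show ?thesis
        using isoperimetry_opened_roundabout[of G num \<gamma> T, OF sg num(1,2)
            plane_graph_card_edges_le[OF assms(1)] \<gamma>]
        by (simp add: C_def)
    qed
    note degH = degree_opened_roundabout[where num=num, OF sg num(1)]
    have deg1: "card {q \<in> Q. fst q = x} \<le> 3" for x
    proof -
      have "{q \<in> Q. fst q = x} \<subseteq> Pair x ` (?H `` {x})" by (auto simp: Q_def)
      then have "card {q \<in> Q. fst q = x} \<le> card (?H `` {x})"
        using degH[of x] by (intro surj_card_le) auto
      then show ?thesis using degH[of x] by simp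
    qed
    have deg2: "card {q \<in> Q. snd q = x} \<le> 3" for x
    proof -
      have "{q \<in> Q. snd q = x} \<subseteq> (\<lambda>y. (y, x)) ` (?H `` {x})"
        using sym_opened_roundabout[of G num] by (auto simp: Q_def dest: symD)
      then have "card {q \<in> Q. snd q = x} \<le> card (?H `` {x})"
        using degH[of x] by (intro surj_card_le) auto
      then show ?thesis using degH[of x] by simp
    qed
    have "(\<Sum>x\<in>W. (f x)\<^sup>2) = (\<Sum>x\<in>S. (g x)\<^sup>2)"
      using W(1) by (intro sum.mono_neutral_cong_right) (auto simp: S_def g_def)
    also have "\<dots> \<le> 4 * real 3 * C\<^sup>2 * (\<Sum>q\<in>Q. (g (fst q) - g (snd q))\<^sup>2)"
      by (rule sum_square_le_energy[OF finQ finS C _ iso deg1 deg2]) (auto simp: S_def g_def)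
    also have "\<dots> \<le> 4 * real 3 * C\<^sup>2 *
        (\<Sum>q\<in>Sigma W (\<lambda>x. neighbours ?R x \<inter> W). (g (fst q) - g (snd q))\<^sup>2)"
      using W(1) HR by (intro mult_left_mono sum_mono2) (auto simp: Q_def)
    also have "(\<Sum>q\<in>Sigma W (\<lambda>x. neighbours ?R x \<inter> W). (g (fst q) - g (snd q))\<^sup>2) = (\<Sum>x\<in>W. \<Sum>y\<in>neighbours ?R x \<inter> W. (f x - f y)\<^sup>2)"
      using W(1) by (subst sum.Sigma) (auto simp: g_def intro!: sum.cong)
    finally show "(\<Sum>x\<in>W. (f x)\<^sup>2) \<le> 4 * 3 * C\<^sup>2 * (\<Sum>x\<in>W. \<Sum>y\<in>neighbours ?R x \<inter> W. (f x - f y)\<^sup>2)"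
      by simp
  qed
  then show ?thesis
    unfolding roundabout_transient_def
    using neighbours_roundabout[OF sg assms(3)] by (intro transient_if_poincare) auto
qed

end
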